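(* Let $M$ and $N$ be smooth simple closed curves in $\mathbb{R}^2$ with arc lengths $L(M)$ and $L(N)$ and base points $p\in M$ and $q\in N$. Let $\gamma:[0,L(M)]\to M$ and $\xi:[0,L(N)]\to N$ be arc length parametrizations of $M$ and $N$ with $\gamma(0)=p$ and $\xi(0)=q$ that induce the positive orientations of the curves. Let $v,w:[0,L(M)]\to[0,L(N)]$ be given by $v(t)=\frac{L(N)}{L(M)}t$ and $w(t)=-\frac{L(N)}{L(M)}t+L(N)$. If $L(N)\ge L(M)$, then the deformation energy functional $$\Phi(h)=\int_M G\big(h^*g_N-g_M,\,h^*g_N-g_M\big)\,\omega_M$$ has exactly two minimizers in the admissible set $\mathcal{A}=\{h\in \operatorname{Diff}(M,N): h(p)=q\}$: the orientation preserving minimizer $h_1=\xi\circ v\circ\gamma^{-1}$ and the orientation reversing minimizer $h_2=\xi\circ w\circ\gamma^{-1}$ (where $\gamma$ is considered as a function on $[0,L(M))$, so that $\gamma^{-1}(p)=0$). Moreover, the minimal value of $\Phi$ on $\mathcal{A}$ is $$\Phi_{\min}=\frac{\big(L(N)^2-L(M)^2\big)^2}{L(M)^3}.$$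
   Context: Smooth simple closed curves in $\mathbb{R}^2$ are regarded as compact connected oriented embedded $1$-dimensional submanifolds without boundary. $g_M$ and $g_N$ are the Riemannian metrics on $M$ and $N$ inherited from the Euclidean metric of $\mathbb{R}^2$, and $\omega_M$ is the Riemannian volume (arc length) form of $M$. $\operatorname{Diff}(M,N)$ is the set of $C^\infty$ diffeomorphisms from $M$ to $N$, and $h^*g_N$ denotes the pull-back. $G=g_M^*\otimes g_M^*$ is the metric induced by $g_M$ on $T^*M\otimes T^*M$; in a local coordinate, for $B=b_{11}\,dx^1\otimes dx^1$ one has $G(B,B)=b_{11}^2\,([g_M]^{11})^2$, where $[g_M]^{11}$ is the inverse of $[g_M]_{11}$. An arc length parametrization $\gamma:[0,L(M)]\to M$ of a closed curve traverses the curve once at unit speed with $\gamma(0)=\gamma(L(M))$; it is injective on $[0,L(M))$ and extends to a smooth $L(M)$-periodic function on $\mathbb{R}$. The positive orientation is the counterclockwise one. *)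

theory Defs
  imports "HOL-Complex_Analysis.Complex_Analysis" "HOL-Library.FuncSet"
begin

text \<open>The Euclidean plane is the type \<^typ>\<open>complex\<close> with its real inner product
  \<^term>\<open>u \<bullet> v\<close>.\<close>

subsection \<open>Smooth maps and submanifolds\<close>

text \<open>On an open set this is membership in $C^n$: all iterated directional derivatives up to
  order $n$ exist and are continuous.\<close>

primrec C_n_on :: "nat \<Rightarrow> 'a::euclidean_space set \<Rightarrow> ('a \<Rightarrow> 'b::euclidean_space) \<Rightarrow> bool" where
  "C_n_on 0 S f \<longleftrightarrow> continuous_on S f"
| "C_n_on (Suc n) S f \<longleftrightarrow> (\<forall>x\<in>S. f differentiable (at x)) \<and>
     (\<forall>v. C_n_on n S (\<lambda>x. frechet_derivative f (at x) v))"

definition C_infinity_on :: "'a::euclidean_space set \<Rightarrow> ('a \<Rightarrow> 'b::euclidean_space) \<Rightarrow> bool" where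
  "C_infinity_on S f \<longleftrightarrow> (\<forall>n. C_n_on n S f)"

text \<open>Smoothness on an arbitrary subset of Euclidean space: locally the restriction of a
  $C^\infty$ map on an open set of the ambient space.\<close>

definition smooth_map :: "'a::euclidean_space set \<Rightarrow> ('a \<Rightarrow> 'b::euclidean_space) \<Rightarrow> bool" where
  "smooth_map X f \<longleftrightarrow>
     (\<forall>x\<in>X. \<exists>U F. open U \<and> x \<in> U \<and> C_infinity_on U F \<and> (\<forall>y\<in>U \<inter> X. F y = f y))"

text \<open>A map defined on \<open>X\<close> only is represented by a function that is \<^const>\<open>undefined\<close>
  outside \<open>X\<close>, so that equality of functions is equality of maps on \<open>X\<close>.\<close>

definition Diff :: "'a::euclidean_space set \<Rightarrow> 'b::euclidean_space set \<Rightarrow> ('a \<Rightarrow> 'b) set" where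
  "Diff X Y = {h \<in> extensional X. bij_betw h X Y \<and> smooth_map X h \<and>
     smooth_map Y (the_inv_into X h)}"

definition submanifold_1 :: "complex set \<Rightarrow> bool" where
  "submanifold_1 M \<longleftrightarrow>
     (\<forall>p\<in>M. \<exists>W (V :: real set). openin (top_of_set M) W \<and> p \<in> W \<and> open V \<and> Diff W V \<noteq> {})"

definition smooth_simple_closed_curve :: "complex set \<Rightarrow> bool" where
  "smooth_simple_closed_curve M \<longleftrightarrow> M \<noteq> {} \<and> compact M \<and> connected M \<and> submanifold_1 M"

subsection \<open>Tangent spaces and covariant 2-tensors\<close>

definition curve_through :: "complex set \<Rightarrow> complex \<Rightarrow> complex \<Rightarrow> (real \<Rightarrow> complex) \<Rightarrow> bool" where
  "curve_through M p v c \<longleftrightarrow>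
     (\<exists>e>0. C_infinity_on {-e<..<e} c \<and> c ` {-e<..<e} \<subseteq> M) \<and>
     c 0 = p \<and> (c has_vector_derivative v) (at 0)"

definition tangent_space :: "complex set \<Rightarrow> complex \<Rightarrow> complex set" where
  "tangent_space M p = {v. \<exists>c. curve_through M p v c}"

text \<open>The tangent map at \<open>p\<close>, defined on \<^term>\<open>tangent_space M p\<close>.\<close>

definition tangent_map ::
    "complex set \<Rightarrow> (complex \<Rightarrow> complex) \<Rightarrow> complex \<Rightarrow> complex \<Rightarrow> complex" where
  "tangent_map M h p v =
     (THE u. \<forall>c. curve_through M p v c \<longrightarrow> ((\<lambda>t. h (c t)) has_vector_derivative u) (at 0))"

text \<open>A covariant 2-tensor field takes a point and two tangent vectors at that point; only its
  values on tangent vectors are meaningful.\<close>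

type_synonym tensor2 = "complex \<Rightarrow> complex \<Rightarrow> complex \<Rightarrow> real"

definition induced_metric :: "complex set \<Rightarrow> tensor2" where
  "induced_metric M p u v =
     (if u \<in> tangent_space M p \<and> v \<in> tangent_space M p then u \<bullet> v else 0)"

definition pullback :: "complex set \<Rightarrow> (complex \<Rightarrow> complex) \<Rightarrow> tensor2 \<Rightarrow> tensor2" where
  "pullback M h g p u v = g (h p) (tangent_map M h p u) (tangent_map M h p v)"

text \<open>The metric induced on $T^*M \otimes T^*M$. In a local coordinate with coordinate vector \<open>X\<close>
  at \<open>p\<close> (any nonzero tangent vector arises in this way), the components of \<open>B\<close>, \<open>C\<close> and of the
  metric are their values at \<open>(X, X)\<close>; the result does not depend on \<open>X\<close>.\<close>

definition tensor_metric :: "complex set \<Rightarrow> complex \<Rightarrow> tensor2 \<Rightarrow> tensor2 \<Rightarrow> real" where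
  "tensor_metric M p B C =
     (THE r. \<forall>X \<in> tangent_space M p - {0}.
        r = B p X X * C p X X * (inverse (induced_metric M p X X))\<^sup>2)"

subsection \<open>Parametrizations, arc length and orientation\<close>

definition closed_parametrization :: "complex set \<Rightarrow> real \<Rightarrow> (real \<Rightarrow> complex) \<Rightarrow> bool" where
  "closed_parametrization M T c \<longleftrightarrow> 0 < T \<and> C_infinity_on UNIV c \<and> (\<forall>t. c (t + T) = c t) \<and>
     (\<forall>t. vector_derivative c (at t) \<noteq> 0) \<and> inj_on c {0..<T} \<and> c ` {0..<T} = M"

text \<open>The integral of \<open>f\<close> times the Riemannian volume form. Along an orientation preserving
  parametrization \<open>c\<close> the volume form takes the value $\sqrt{g_M(c', c')}$ on $c'$; reversing
  the orientation of \<open>M\<close> does not change the integral.\<close>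

definition volume_integral :: "complex set \<Rightarrow> (complex \<Rightarrow> real) \<Rightarrow> real" where
  "volume_integral M f =
     (THE I. \<forall>T c. closed_parametrization M T c \<longrightarrow>
        ((\<lambda>t. f (c t) * sqrt (induced_metric M (c t)
            (vector_derivative c (at t)) (vector_derivative c (at t)))) has_integral I) {0..T})"

definition arc_length :: "complex set \<Rightarrow> real" where
  "arc_length M = volume_integral M (\<lambda>_. 1)"

text \<open>Only the values of \<open>\<gamma>\<close> on the interval from \<open>0\<close> to \<^term>\<open>arc_length M\<close> matter; \<open>c\<close> is
  the smooth periodic extension.\<close>

definition arc_length_parametrization :: "complex set \<Rightarrow> (real \<Rightarrow> complex) \<Rightarrow> bool" where
  "arc_length_parametrization M \<gamma> \<longleftrightarrow>
     (\<exists>c. closed_parametrization M (arc_length M) c \<and>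
        (\<forall>t. norm (vector_derivative c (at t)) = 1) \<and>
        (\<forall>t\<in>{0..arc_length M}. \<gamma> t = c t))"

text \<open>Counterclockwise traversal of \<open>M\<close> by \<open>c\<close> on the interval from \<open>0\<close> to \<open>T\<close>.\<close>

definition positively_oriented :: "complex set \<Rightarrow> real \<Rightarrow> (real \<Rightarrow> complex) \<Rightarrow> bool" where
  "positively_oriented M T c \<longleftrightarrow> (\<forall>z\<in>inside M. winding_number (\<lambda>s. c (T * s)) z = 1)"

definition positive_tangent :: "complex set \<Rightarrow> complex \<Rightarrow> complex \<Rightarrow> bool" where
  "positive_tangent M p v \<longleftrightarrow>
     (\<exists>T c t a. closed_parametrization M T c \<and> positively_oriented M T c \<and>
        c t = p \<and> 0 < a \<and> v = a *\<^sub>R vector_derivative c (at t))"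

definition orientation_preserving ::
    "complex set \<Rightarrow> complex set \<Rightarrow> (complex \<Rightarrow> complex) \<Rightarrow> bool" where
  "orientation_preserving M N h \<longleftrightarrow>
     (\<forall>p\<in>M. \<forall>v. positive_tangent M p v \<longrightarrow> positive_tangent N (h p) (tangent_map M h p v))"

definition orientation_reversing ::
    "complex set \<Rightarrow> complex set \<Rightarrow> (complex \<Rightarrow> complex) \<Rightarrow> bool" where
  "orientation_reversing M N h \<longleftrightarrow>
     (\<forall>p\<in>M. \<forall>v. positive_tangent M p v \<longrightarrow> positive_tangent N (h p) (- tangent_map M h p v))"

subsection \<open>The deformation energy\<close>

definition deformation_energy ::
    "complex set \<Rightarrow> complex set \<Rightarrow> (complex \<Rightarrow> complex) \<Rightarrow> real" where
  "deformation_energy M N h =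
     (let B = (\<lambda>p u v. pullback M h (induced_metric N) p u v - induced_metric M p u v)
      in volume_integral M (\<lambda>p. tensor_metric M p B B))"

definition admissible ::
    "complex set \<Rightarrow> complex set \<Rightarrow> complex \<Rightarrow> complex \<Rightarrow> (complex \<Rightarrow> complex) set" where
  "admissible M N p q = {h \<in> Diff M N. h p = q}"

end

theory Submission
  imports Defs
begin

text \<open>The tangent map, the tensor metric and the volume integral are defined by
  \<open>THE\<close>, and smoothness on a curve by local extensions to the plane. One construction,
  \<open>local_chart\<close>, answers both: near each point of the curve it provides an inverse of
  \<open>c\<close> on an open set of the plane. It shows that every smooth curve through a point of
  \<open>M\<close> is locally a reparametrization of \<open>c\<close>, which determines the tangent
  objects; it yields the derivative of a lift; and it makes the affine candidates smooth. That
  \<phi> L is one of \<plusminus> K comes from injectivity: over one period the lift can neither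
  return to its start nor pass a full period too early. Uniqueness is most delicate for K = L, where
  \<phi>' = 1 and \<phi>' = - 1 both make the integrand vanish; the mean value of \<phi>' decides
  between them.\<close>

text \<open>Let \<open>c\<close> and \<open>k\<close> be the periodic unit speed parametrizations of \<open>M\<close> and \<open>N\<close>, of periods \<open>L\<close> and
  \<open>K\<close>. A diffeomorphism \<open>h\<close> with \<open>h p = q\<close> lifts to a function \<open>\<phi>\<close> on the line with
  \<open>h (c t) = k (\<phi> t)\<close>, \<open>\<phi> 0 = 0\<close> and \<open>\<phi> L = \<plusminus> K\<close>, and its energy is the integral of
  \<open>((\<phi>' t)\<^sup>2 - 1)\<^sup>2\<close> over one period. Since \<open>K / L \<ge> 1\<close>, the integrand is bounded below by its
  tangent line at \<open>K / L\<close>, whose integral depends only on \<open>\<phi> L\<close>; equality forces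
  \<open>\<phi> t = \<plusminus> (K / L) * t\<close>.\<close>

subsection \<open>Calculus of smooth functions\<close>

lemma C_n_on_subset: "C_n_on n S f \<Longrightarrow> T \<subseteq> S \<Longrightarrow> C_n_on n T f"
  by (induction n arbitrary: f) (auto intro: continuous_on_subset)

lemma C_n_on_imp_continuous_on: "C_n_on n S f \<Longrightarrow> continuous_on S f"
  by (cases n) (auto intro!: continuous_at_imp_continuous_on differentiable_imp_continuous_within)

lemma C_n_on_SucD: "C_n_on (Suc n) S f \<Longrightarrow> C_n_on n S f"
proof (induction n arbitrary: f)
  case 0
  then show ?case using C_n_on_imp_continuous_on[of "Suc 0"] by simp
next
  case (Suc n)
  have "C_n_on n S (\<lambda>x. frechet_derivative f (at x) v)" for v
    by (rule Suc.IH) (use Suc.prems C_n_on.simps(2)[of "Suc n" S f] in blast)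
  then show ?case using Suc.prems C_n_on.simps(2) by blast
qed

text \<open>Derivatives in \<open>C_n_on\<close> are taken in the whole space, so agreement on
  \<open>S\<close> has to be agreement near each point. Openness provides this, and it passes on to
  all iterated derivatives.\<close>

lemma C_n_on_cong:
  assumes "open S" "\<And>x. x \<in> S \<Longrightarrow> f x = g x"
  shows "C_n_on n S f \<longleftrightarrow> C_n_on n S g"
proof -
  have imp: "C_n_on n S g" if "C_n_on n S f" "\<And>x. x \<in> S \<Longrightarrow> f x = g x" for f g :: "'a \<Rightarrow> 'b"
    using that
  proof (induction n arbitrary: f g)
    case 0
    then show ?case using continuous_on_cong[of S S f g] by simp
  next
    case (Suc n)
    have d: "(g has_derivative frechet_derivative f (at x)) (at x)" if "x \<in> S" for x
    proof -
      have "(f has_derivative frechet_derivative f (at x)) (at x)"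
        using Suc.prems(1) that by (simp add: frechet_derivative_works)
      then show ?thesis
        by (rule has_derivative_transform_within_open[OF _ assms(1) that]) (use Suc.prems in auto)
    qed
    moreover have "C_n_on n S (\<lambda>x. frechet_derivative g (at x) v)" for v
      by (rule Suc.IH[of "\<lambda>x. frechet_derivative f (at x) v"])
        (use Suc.prems frechet_derivative_at[OF d] in auto)
    ultimately show ?case by (auto simp: differentiable_def)
  qed
  show ?thesis using imp assms(2) by metis
qed

text \<open>An explicit derivative \<open>f'\<close> may replace the choice term
  \<open>frechet_derivative\<close>. The closure lemmas below are inductions through this
  rule.\<close>

lemma C_n_on_SucI:
  assumes "open S" "\<And>x. x \<in> S \<Longrightarrow> (f has_derivative f' x) (at x)"
    "\<And>v. C_n_on n S (\<lambda>x. f' x v)"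
  shows "C_n_on (Suc n) S f"
proof -
  have "C_n_on n S (\<lambda>x. frechet_derivative f (at x) v)" for v
    using C_n_on_cong[OF assms(1), of "\<lambda>x. f' x v" "\<lambda>x. frechet_derivative f (at x) v" n]
      frechet_derivative_at[OF assms(2)] assms(3) by simp
  then show ?thesis using assms(2) by (auto simp: differentiable_def)
qed

lemma C_n_on_SucE:
  assumes "C_n_on (Suc n) S f"
  shows "\<And>x. x \<in> S \<Longrightarrow> (f has_derivative frechet_derivative f (at x)) (at x)"
    "\<And>v. C_n_on n S (\<lambda>x. frechet_derivative f (at x) v)"
  using assms by (auto simp: frechet_derivative_works)


section \<open>Closure of smoothness under algebraic operations and composition\<close>

lemma C_n_on_add:
  assumes "open S"
  shows "C_n_on n S f \<Longrightarrow> C_n_on n S g \<Longrightarrow> C_n_on n S (\<lambda>x. f x + g x)"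
proof (induction n arbitrary: f g)
  case 0
  then show ?case by (simp add: continuous_on_add)
next
  case (Suc n)
  note E = C_n_on_SucE[OF Suc.prems(1)] C_n_on_SucE[OF Suc.prems(2)]
  show ?case
  proof (rule C_n_on_SucI[OF assms(1)])
    show "((\<lambda>x. f x + g x) has_derivative
        (\<lambda>v. frechet_derivative f (at x) v + frechet_derivative g (at x) v)) (at x)" if "x \<in> S" for x
      by (rule has_derivative_add[OF E(1)[OF that] E(3)[OF that]])
    show "C_n_on n S (\<lambda>x. frechet_derivative f (at x) v + frechet_derivative g (at x) v)" for v
      by (rule Suc.IH[OF E(2) E(4)])
  qed
qed

lemma C_n_on_bounded_linear:
  assumes "open S" "bounded_linear F"
  shows "C_n_on n S f \<Longrightarrow> C_n_on n S (\<lambda>x. F (f x))"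
proof (induction n arbitrary: f)
  case 0
  then show ?case using bounded_linear.continuous_on[OF assms(2)] by simp
next
  case (Suc n)
  note E = C_n_on_SucE[OF Suc.prems]
  show ?case
  proof (rule C_n_on_SucI[OF assms(1)])
    show "((\<lambda>x. F (f x)) has_derivative (\<lambda>v. F (frechet_derivative f (at x) v))) (at x)" if "x \<in> S" for x
      by (rule bounded_linear.has_derivative[OF assms(2) E(1)[OF that]])
    show "C_n_on n S (\<lambda>x. F (frechet_derivative f (at x) v))" for v
      by (rule Suc.IH[OF E(2)])
  qed
qed

lemma C_n_on_scaleR:
  assumes "open S"
  shows "C_n_on n S f \<Longrightarrow> C_n_on n S g \<Longrightarrow> C_n_on n S (\<lambda>x. f x *\<^sub>R g x)"
proof (induction n arbitrary: f g)
  case 0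
  then show ?case by (simp add: continuous_on_scaleR)
next
  case (Suc n)
  note E = C_n_on_SucE[OF Suc.prems(1)] C_n_on_SucE[OF Suc.prems(2)]
  note D = C_n_on_SucD[OF Suc.prems(1)] C_n_on_SucD[OF Suc.prems(2)]
  show ?case
  proof (rule C_n_on_SucI[OF assms(1)])
    show "((\<lambda>x. f x *\<^sub>R g x) has_derivative (\<lambda>v. f x *\<^sub>R frechet_derivative g (at x) v
        + frechet_derivative f (at x) v *\<^sub>R g x)) (at x)" if "x \<in> S" for x
      by (rule has_derivative_scaleR[OF E(1)[OF that] E(3)[OF that]])
    show "C_n_on n S (\<lambda>x. f x *\<^sub>R frechet_derivative g (at x) v
        + frechet_derivative f (at x) v *\<^sub>R g x)" for v
      by (rule C_n_on_add[OF assms(1) Suc.IH[OF D(1) E(4)] Suc.IH[OF E(2) D(2)]])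
  qed
qed

lemma C_n_on_inverse:
  fixes f :: "'a::euclidean_space \<Rightarrow> real"
  assumes "open S" "\<And>x. x \<in> S \<Longrightarrow> f x \<noteq> 0"
  shows "C_n_on n S f \<Longrightarrow> C_n_on n S (\<lambda>x. inverse (f x))"
proof (induction n)
  case 0
  then show ?case using assms(2) by (auto intro: continuous_intros)
next
  case (Suc n)
  have inv: "C_n_on n S (\<lambda>x. inverse (f x))" using Suc C_n_on_SucD by blast
  note E = C_n_on_SucE[OF Suc.prems]
  show ?case
  proof (rule C_n_on_SucI[OF assms(1)])
    show "((\<lambda>x. inverse (f x)) has_derivative
        (\<lambda>v. inverse (f x) *\<^sub>R (inverse (f x) *\<^sub>R (- frechet_derivative f (at x) v)))) (at x)"
      if "x \<in> S" for x
      using Deriv.has_derivative_inverse[OF assms(2)[OF that] E(1)[OF that]] by (simp add: mult_ac)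
    show "C_n_on n S (\<lambda>x. inverse (f x) *\<^sub>R (inverse (f x) *\<^sub>R (- frechet_derivative f (at x) v)))" for v
      by (rule C_n_on_scaleR[OF assms(1) inv C_n_on_scaleR[OF assms(1) inv
          C_n_on_bounded_linear[OF assms(1) bounded_linear_minus[OF bounded_linear_ident] E(2)]]])
  qed
qed

text \<open>Since \<open>l'\<close> does not depend on the point, differentiating the composition in
  direction \<open>v\<close> gives the derivative of \<open>f\<close> in the fixed direction
  \<open>l' v\<close>, again composed with \<open>l\<close>. The induction closes without product
  terms.\<close>

lemma C_n_on_compose_affine:
  assumes "open T" "\<And>x. (l has_derivative l') (at x)" "l ` T \<subseteq> S"
  shows "C_n_on n S f \<Longrightarrow> C_n_on n T (\<lambda>x. f (l x))"
proof (induction n arbitrary: f)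
  case 0
  have "continuous_on T l"
    by (intro continuous_at_imp_continuous_on ballI has_derivative_continuous[OF assms(2)])
  then show ?case using continuous_on_compose2[of S f T l] 0 assms(3) by simp
next
  case (Suc n)
  note E = C_n_on_SucE[OF Suc.prems]
  have "((\<lambda>x. f (l x)) has_derivative (\<lambda>v. frechet_derivative f (at (l x)) (l' v))) (at x)" if "x \<in> T" for x
    by (rule has_derivative_compose[OF assms(2)]) (use E(1) assms(3) that in auto)
  moreover have "C_n_on n T (\<lambda>x. frechet_derivative f (at (l x)) (l' v))" for v
    by (rule Suc.IH[OF E(2)])
  ultimately show ?case by (rule C_n_on_SucI[OF assms(1)])
qed

text \<open>The derivative of \<open>f \<circ> g\<close> at \<open>y\<close> is $(f'/u) \circ g$, which has the same shape, so the
  induction goes through without a general chain rule for higher derivatives.\<close>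

lemma C_n_on_compose_inverse_function:
  fixes g u :: "real \<Rightarrow> real"
  assumes "open S" "open T" "g ` T \<subseteq> S" "C_n_on n S u" "\<And>x. x \<in> S \<Longrightarrow> u x \<noteq> 0"
    and g: "\<And>y. y \<in> T \<Longrightarrow> (g has_real_derivative inverse (u (g y))) (at y)"
  shows "C_n_on n S f \<Longrightarrow> C_n_on n T (\<lambda>y. f (g y))"
  using assms(4)
proof (induction n arbitrary: f)
  case 0
  have "continuous_on T g"
    by (intro continuous_at_imp_continuous_on ballI DERIV_isCont[OF g])
  then show ?case using continuous_on_compose2[of S f T g] 0 assms(3) by simp
next
  case (Suc n)
  note E = C_n_on_SucE[OF Suc.prems(1)]
  show ?case
  proof (rule C_n_on_SucI[OF assms(2)])
    show "((\<lambda>y. f (g y)) has_derivative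
        (\<lambda>v. inverse (u (g y)) *\<^sub>R frechet_derivative f (at (g y)) v)) (at y)" if "y \<in> T" for y
    proof -
      have "(f has_derivative frechet_derivative f (at (g y))) (at (g y))"
        using E(1) that assms(3) by blast
      from has_derivative_compose[OF g[OF that, unfolded has_field_derivative_def] this]
      show ?thesis
        by (simp add: linear_scale[OF has_derivative_linear
              [OF \<open>(f has_derivative _) _\<close>], of "inverse (u (g y))", simplified])
    qed
    have "C_n_on n S (\<lambda>x. inverse (u x) *\<^sub>R frechet_derivative f (at x) v)" for v
      by (intro C_n_on_scaleR C_n_on_inverse assms(1,5) E(2) C_n_on_SucD[OF Suc.prems(2)])
    from Suc.IH[OF this C_n_on_SucD[OF Suc.prems(2)]]
    show "C_n_on n T (\<lambda>y. inverse (u (g y)) *\<^sub>R frechet_derivative f (at (g y)) v)" for v .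
  qed
qed

lemma C_infinity_on_curveD:
  fixes c :: "real \<Rightarrow> 'b::euclidean_space"
  assumes "C_infinity_on UNIV c"
  shows "(c has_vector_derivative vector_derivative c (at t)) (at t)"
    and "C_infinity_on UNIV (\<lambda>t. vector_derivative c (at t))"
proof -
  have C: "C_n_on (Suc n) UNIV c" for n
    using assms unfolding C_infinity_on_def by blast
  then have d: "c differentiable (at t)" for t
    using C_n_on.simps(2) by blast
  then show "(c has_vector_derivative vector_derivative c (at t)) (at t)"
    by (simp add: vector_derivative_works)
  have "(\<lambda>t. frechet_derivative c (at t) 1) = (\<lambda>t. vector_derivative c (at t))"
    by (simp add: frechet_derivative_eq_vector_derivative[OF d])
  then show "C_infinity_on UNIV (\<lambda>t. vector_derivative c (at t))"
    using C_n_on_SucE(2)[OF C] unfolding C_infinity_on_def by metis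
qed

lemma C_infinity_on_imp_continuous_on: "C_infinity_on S f \<Longrightarrow> continuous_on S f"
  unfolding C_infinity_on_def using C_n_on_imp_continuous_on by blast

subsection \<open>Unit speed loops\<close>

lemma translate_into_period:
  fixes t T a :: real
  assumes "0 < T"
  obtains n :: int where "t + of_int n * T \<in> {a..<a + T}"
proof
  have "of_int \<lfloor>(t - a) / T\<rfloor> * T \<le> t - a" "t - a < (of_int \<lfloor>(t - a) / T\<rfloor> + 1) * T"
    using of_int_floor_le[of "(t - a) / T"] real_of_int_floor_add_one_gt[of "(t - a) / T"]
    by (simp_all only: pos_le_divide_eq[OF assms] pos_divide_less_eq[OF assms])
  then show "t + of_int (- \<lfloor>(t - a) / T\<rfloor>) * T \<in> {a..<a + T}"
    by (simp add: algebra_simps)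
qed

lemma periodic_of_int:
  fixes f :: "real \<Rightarrow> 'a" and T :: real
  assumes "\<And>t. f (t + T) = f t"
  shows "f (t + of_int n * T) = f t"
proof (induction n)
  case (nonneg n)
  show ?case
  proof (induction n)
    case (Suc n)
    then show ?case using assms[of "t + of_nat n * T"] by (simp add: algebra_simps)
  qed simp
next
  case (neg n)
  have "f (t - of_nat m * T) = f t" for m
  proof (induction m)
    case (Suc m)
    then show ?case using assms[of "t - of_nat (Suc m) * T"] by (simp add: algebra_simps)
  qed simp
  from this[of "Suc n"] show ?case by (simp add: algebra_simps)
qed

lemma closed_parametrizationD:
  assumes "closed_parametrization M T c"
  shows "0 < T" "(c has_vector_derivative vector_derivative c (at t)) (at t)"
    "C_infinity_on UNIV (\<lambda>t. vector_derivative c (at t))" "continuous_on UNIV c"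
    "c (t + of_int n * T) = c t" "range c = M" "c s = c t \<longleftrightarrow> (\<exists>n::int. s = t + of_int n * T)"
    "vector_derivative c (at t) \<noteq> 0"
proof -
  have c: "0 < T" "C_infinity_on UNIV c" "\<And>t. c (t + T) = c t" "inj_on c {0..<T}" "c ` {0..<T} = M"
    using assms unfolding closed_parametrization_def by auto
  note per = periodic_of_int[of c T, OF c(3)]
  show "0 < T" "continuous_on UNIV c" "c (t + of_int n * T) = c t"
    "(c has_vector_derivative vector_derivative c (at t)) (at t)"
    "C_infinity_on UNIV (\<lambda>t. vector_derivative c (at t))"
    using c(1) per C_infinity_on_curveD[OF c(2)] C_infinity_on_imp_continuous_on[OF c(2)] by auto
  show "vector_derivative c (at t) \<noteq> 0"
    using assms unfolding closed_parametrization_def by auto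
  have red: "\<exists>n::int. t + of_int n * T \<in> {0..<T}" for t
    using translate_into_period[OF c(1), of t 0] by auto
  show "range c = M"
    using red per c(5) by (metis (no_types, lifting) UNIV_I imageE imageI subsetI subset_antisym)
  show "c s = c t \<longleftrightarrow> (\<exists>n::int. s = t + of_int n * T)"
  proof
    assume eq: "c s = c t"
    obtain m n :: int where mn: "s + of_int m * T \<in> {0..<T}" "t + of_int n * T \<in> {0..<T}"
      using red by blast
    then have "s + of_int m * T = t + of_int n * T"
      using inj_onD[OF c(4) _ mn] per eq by metis
    then have "s = t + of_int (n - m) * T" by (simp add: algebra_simps)
    then show "\<exists>n::int. s = t + of_int n * T" by blast
  qed (use per in auto)
qed

text \<open>Here \<open>c\<close> is the periodic extension to the whole line, so there are no
  endpoints with one-sided derivatives. The period is a parameter that becomes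
  \<open>arc_length M\<close> only at the end.\<close>

locale unit_speed_loop =
  fixes M :: "complex set" and L :: real and c :: "real \<Rightarrow> complex"
  assumes par: "closed_parametrization M L c"
    and unit: "\<And>t. norm (vector_derivative c (at t)) = 1"
begin

abbreviation c' :: "real \<Rightarrow> complex" where
  "c' t \<equiv> vector_derivative c (at t)"

lemmas L_pos = closed_parametrizationD(1)[OF par]
  and deriv = closed_parametrizationD(2)[OF par]
  and c'_smooth = closed_parametrizationD(3)[OF par]
  and cont = closed_parametrizationD(4)[OF par]
  and periodic = closed_parametrizationD(5)[OF par]
  and range = closed_parametrizationD(6)[OF par]
  and eq_iff = closed_parametrizationD(7)[OF par]

lemma smooth: "C_infinity_on UNIV c"
  using par unfolding closed_parametrization_def by simp

lemma c'_cont: "continuous_on UNIV c'"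
  by (rule C_infinity_on_imp_continuous_on[OF c'_smooth])

lemma in_M [simp]: "c t \<in> M"
  using range by auto

lemma obtain_parameter:
  assumes "y \<in> M" obtains t where "y = c t" "t \<in> {a..<a + L}"
proof -
  obtain s where s: "y = c s" using assms range by auto
  obtain n :: int where "s + of_int n * L \<in> {a..<a + L}" using translate_into_period[OF L_pos] .
  then show ?thesis using that s periodic by metis
qed

lemma c'_inner_self: "c' t \<bullet> c' t = 1"
  using unit by (simp add: dot_square_norm)

text \<open>Orthogonal projection to the tangent line at \<open>c t0\<close> is strictly monotone
  along a short arc, so the parameter can be recovered from it; this defines \<open>F\<close> off
  the curve as well. Other arcs of \<open>M\<close> may have the same projection, so
  \<open>U\<close> leaves them out. Smoothness is stated for \<open>G\<close> after \<open>F\<close>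
  because affine maps between loops take this form.\<close>

lemma local_chart:
  obtains U F where "open U" "c t0 \<in> U" "\<And>y. y \<in> U \<inter> M \<Longrightarrow> c (F y) = y"
    "\<forall>\<^sub>F t in nhds t0. F (c t) = t"
    "(F has_derivative (\<lambda>x. x \<bullet> c' t0)) (at (c t0))"
    "\<And>G :: real \<Rightarrow> complex. C_infinity_on UNIV G \<Longrightarrow> C_infinity_on U (\<lambda>y. G (F y))"
proof -
  define l where "l y = (y - c t0) \<bullet> c' t0" for y
  define f where "f t = l (c t)" for t
  define u where "u t = c' t \<bullet> c' t0" for t
  have f_deriv: "(f has_real_derivative u t) (at t)" for t
    unfolding f_def l_def u_def has_real_derivative_iff_has_vector_derivative
    using bounded_linear.has_vector_derivative[OF bounded_linear_inner_left
        has_vector_derivative_diff[OF deriv has_vector_derivative_const]] by simp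
  have l_deriv: "(l has_derivative (\<lambda>x. x \<bullet> c' t0)) (at y)" for y
    unfolding l_def by (auto intro!: derivative_eq_intros)
  have "isCont u t0"
    unfolding u_def using c'_cont by (auto intro!: continuous_intros simp: continuous_on_eq_continuous_at)
  moreover have "u t0 = 1" unfolding u_def by (rule c'_inner_self)
  ultimately have "\<forall>\<^sub>F t in at t0. 0 < u t"
    by (intro order_tendstoD(1)[of u 1]) (auto simp: isCont_def)
  then obtain d where d: "0 < d" "\<And>t. t \<noteq> t0 \<Longrightarrow> dist t t0 < d \<Longrightarrow> 0 < u t"
    unfolding eventually_at by auto
  \<comment> \<open>The bound \<open>L / 3\<close> keeps \<delta> below half a period, so that the
    parameter interval of \<open>K\<close> below contains its right endpoint
    \<open>t0 + L - \<delta>\<close>.\<close>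
  define \<delta> where "\<delta> = min d (L / 3)"
  have \<delta>: "0 < \<delta>" "\<delta> < L / 2" using d L_pos by (auto simp: \<delta>_def)
  define I where "I = {t0 - \<delta><..<t0 + \<delta>}"
  have I: "open I" "t0 \<in> I" using \<delta> by (auto simp: I_def)
  have u_pos: "0 < u t" if "t \<in> I" for t
    using that d(2)[of t] \<open>u t0 = 1\<close> by (cases "t = t0") (auto simp: I_def \<delta>_def dist_real_def)
  have mono: "f s < f t" if "s \<in> I" "t \<in> I" "s < t" for s t
  proof (rule DERIV_pos_imp_increasing[OF that(3)])
    fix x assume "s \<le> x" "x \<le> t"
    then have "x \<in> I" using that by (auto simp: I_def)
    then show "\<exists>y. (f has_real_derivative y) (at x) \<and> 0 < y" using f_deriv u_pos by blast
  qed
  then have inj: "inj_on f I" by (metis inj_onI linorder_neqE_linordered_idom order_less_irrefl)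
  have f_cont: "continuous_on I f"
    by (intro continuous_at_imp_continuous_on ballI DERIV_isCont[OF f_deriv])
  define J where "J = f ` I"
  have "open J" unfolding J_def by (rule invariance_of_domain[OF f_cont I(1) inj])
  define \<psi> where "\<psi> = the_inv_into I f"
  have \<psi>_f: "\<psi> (f t) = t" if "t \<in> I" for t
    unfolding \<psi>_def by (rule the_inv_into_f_f[OF inj that])
  have \<psi>_deriv: "(\<psi> has_real_derivative inverse (u t)) (at (f t))" if "t \<in> I" for t
    unfolding has_field_derivative_def
    by (rule has_derivative_inverse_strong[OF I(1) that f_cont \<psi>_f f_deriv[unfolded has_field_derivative_def]])
      (use u_pos[OF that] in \<open>auto simp: fun_eq_iff\<close>)
  have \<psi>_J: "\<psi> ` J \<subseteq> I" using \<psi>_f by (auto simp: J_def)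
  define F where "F y = \<psi> (l y)" for y
  define K where "K = c ` {t0 + \<delta>..t0 + L - \<delta>}"
  have "compact K" unfolding K_def
    by (intro compact_continuous_image continuous_on_subset[OF cont]) auto
  define U where "U = l -` J \<inter> - K"
  have l_cont: "continuous_on UNIV l"
    by (intro continuous_at_imp_continuous_on ballI has_derivative_continuous[OF l_deriv])
  have "open U" unfolding U_def
    by (intro open_Int open_vimage \<open>open J\<close> l_cont open_Compl compact_imp_closed \<open>compact K\<close>)
  have "c t0 \<notin> K"
  proof
    assume "c t0 \<in> K"
    then obtain s n where s: "s \<in> {t0 + \<delta>..t0 + L - \<delta>}" "s = t0 + of_int n * L"
      unfolding K_def using eq_iff by (metis imageE)
    then have "0 < of_int n * L" "of_int n * L < 1 * L"
      using \<delta> unfolding mult_1_left atLeastAtMost_iff by linarith+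
    then have "0 < real_of_int n" "real_of_int n < 1"
      using L_pos by (simp_all only: mult_less_cancel_right_pos zero_less_mult_pos2)
    then show False by simp
  qed
  then have c_U: "c t0 \<in> U"
    using I(2) unfolding U_def J_def f_def by auto
  show thesis
  proof (rule that[OF \<open>open U\<close> c_U])
    fix y assume y: "y \<in> U \<inter> M"
    then obtain t where t: "y = c t" "t \<in> {t0 - \<delta>..<t0 - \<delta> + L}" using obtain_parameter by blast
    \<comment> \<open>The half-open window includes its left end, which lies one period before the
      right end of the interval that defines \<open>K\<close>.\<close>
    have "t \<noteq> t0 - \<delta>"
    proof
      assume "t = t0 - \<delta>"
      then have "y = c (t0 - \<delta> + L)" using t periodic[of "t0 - \<delta>" 1] by simp
      then have "y \<in> K" using \<delta> by (auto simp: K_def)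
      then show False using y U_def by auto
    qed
    moreover have "\<not> t0 + \<delta> \<le> t"
    proof
      assume "t0 + \<delta> \<le> t"
      then have "y \<in> K" using t by (auto simp: K_def)
      then show False using y U_def by auto
    qed
    ultimately have "t \<in> I" using t by (auto simp: I_def)
    then show "c (F y) = y" using \<psi>_f t(1) by (simp add: F_def f_def)
  next
    have "\<forall>\<^sub>F t in nhds t0. t \<in> I" using I by (rule eventually_nhds_in_open)
    then show "\<forall>\<^sub>F t in nhds t0. F (c t) = t"
      by (rule eventually_mono) (use \<psi>_f in \<open>simp add: F_def f_def\<close>)
  next
    have "(\<psi> has_derivative (\<lambda>x. x)) (at (l (c t0)))"
      using \<psi>_deriv[OF I(2)] \<open>u t0 = 1\<close> lambda_one[where 'a = real]
      by (simp add: f_def has_field_derivative_def)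
    from has_derivative_compose[OF l_deriv this]
    show "(F has_derivative (\<lambda>x. x \<bullet> c' t0)) (at (c t0))" by (simp add: F_def[abs_def])
  next
    fix G :: "real \<Rightarrow> complex" assume G: "C_infinity_on UNIV G"
    show "C_infinity_on U (\<lambda>y. G (F y))"
      unfolding C_infinity_on_def F_def
    proof
      fix n
      have "C_n_on n UNIV c'" "C_n_on n UNIV G"
        using c'_smooth G by (auto simp: C_infinity_on_def)
      then have "C_n_on n I u" "C_n_on n I G"
        unfolding u_def using C_n_on_bounded_linear[OF open_UNIV bounded_linear_inner_left] C_n_on_subset
        by blast+
      then have "C_n_on n J (\<lambda>x. G (\<psi> x))"
        using u_pos \<psi>_deriv \<psi>_f
        by (intro C_n_on_compose_inverse_function[OF I(1) \<open>open J\<close> \<psi>_J, of n u])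
          (auto simp: J_def less_imp_neq[symmetric])
      moreover have "l ` U \<subseteq> J" by (auto simp: U_def)
      ultimately show "C_n_on n U (\<lambda>y. G (\<psi> (l y)))"
        by (intro C_n_on_compose_affine[OF \<open>open U\<close> l_deriv, of J n "\<lambda>x. G (\<psi> x)"])
    qed
  qed
qed

end

subsection \<open>Lifts, tangent maps and integrals\<close>

lemma continuous_nonzero_constant_sign:
  fixes f :: "real \<Rightarrow> real"
  assumes "continuous_on UNIV f" "\<And>t. f t \<noteq> 0"
  shows "(\<forall>t. 0 < f t) \<or> (\<forall>t. f t < 0)"
proof (rule ccontr)
  assume "\<not> ?thesis"
  then obtain a b where "f a < 0" "0 < f b"
    using assms(2) by (metis linorder_neqE_linordered_idom)
  moreover have "connected (range f)"
    using assms(1) by (intro connected_continuous_image) auto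
  ultimately have "0 \<in> range f"
    using connectedD_interval[of "range f" "f a" "f b" 0] by (simp add: less_imp_le)
  then show False using assms(2) by auto
qed

lemma integral_over_period:
  fixes f :: "real \<Rightarrow> real"
  assumes "continuous_on UNIV f" "\<And>t. f (t + T) = f t" "0 < T"
  shows "integral {a..a + T} f = integral {0..T} f"
proof -
  have per: "f (t + of_int n * T) = f t" for t n
    by (rule periodic_of_int[of f T, OF assms(2)])
  have shift: "integral {a + of_int n * T..b + of_int n * T} f = integral {a..b} f" for a b n
    using integral_shift[OF continuous_on_subset[OF assms(1)], of a "of_int n * T" b] by (simp add: o_def per)
  obtain n :: int where b: "a + of_int n * T \<in> {0..<0 + T}"
    using translate_into_period[OF assms(3)] .
  define b where "b = a + of_int n * T"
  have int: "f integrable_on {x..y}" for x y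
    by (intro integrable_continuous_interval continuous_on_subset[OF assms(1)]) auto
  have "integral {a..a + T} f = integral {b..b + T} f"
    using shift[of a n "a + T"] by (simp add: b_def algebra_simps)
  also have "\<dots> = integral {b..T} f + integral {T..b + T} f"
    using b int by (intro Henstock_Kurzweil_Integration.integral_combine[symmetric]) (auto simp: b_def)
  also have "integral {T..b + T} f = integral {0..b} f"
    using shift[of 0 1 b] by simp
  also have "integral {b..T} f + integral {0..b} f = integral {0..T} f"
    using b int Henstock_Kurzweil_Integration.integral_combine[of 0 b T f] by (auto simp: b_def)
  finally show ?thesis .
qed

text \<open>Continuity forces a function with no net displacement to take some value twice, on the
  way out and on the way back, and one with displacement of at least two periods to cross \<phi> 0
  \<plusminus> L too early. Only one period in either direction remains.\<close>

lemma degree_one_of_injective: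
  fixes \<phi> :: "real \<Rightarrow> real"
  assumes "0 < T" "0 < L" "continuous_on {0..T} \<phi>" "inj_on \<phi> {0..<T}" "\<phi> T = \<phi> 0 + of_int n * L"
    and ne: "\<And>s m. 0 < s \<Longrightarrow> s < T \<Longrightarrow> \<phi> s \<noteq> \<phi> 0 + of_int m * L"
  shows "\<phi> T = \<phi> 0 + L \<or> \<phi> T = \<phi> 0 - L"
proof -
  have "n \<noteq> 0"
  proof
    assume "n = 0"
    \<comment> \<open>The sign \<sigma> turns the excursion at \<open>T / 2\<close> upward, so one
      argument covers both directions; half its height is then reached on each side of
      \<open>T / 2\<close>.\<close>
    define \<sigma> where "\<sigma> = sgn (\<phi> (T / 2) - \<phi> 0)"
    define y where "y = \<bar>\<phi> (T / 2) - \<phi> 0\<bar>"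
    define \<psi> where "\<psi> s = \<sigma> * (\<phi> s - \<phi> 0)" for s
    have "\<phi> (T / 2) \<noteq> \<phi> 0" using ne[of "T / 2" 0] assms(1) by simp
    then have "0 < y" "\<sigma> \<noteq> 0" "\<psi> (T / 2) = y" "\<psi> 0 = 0" "\<psi> T = 0"
      using assms(5) \<open>n = 0\<close> by (auto simp: y_def \<sigma>_def \<psi>_def sgn_real_def)
    have cont: "continuous_on {0..T / 2} \<psi>" "continuous_on {T / 2..T} \<psi>"
      unfolding \<psi>_def using assms(1) by (auto intro!: continuous_intros continuous_on_subset[OF assms(3)])
    obtain s1 where s1: "0 \<le> s1" "s1 \<le> T / 2" "\<psi> s1 = y / 2"
      using IVT'[of \<psi> 0 "y / 2" "T / 2"] cont \<open>0 < y\<close> \<open>\<psi> (T / 2) = y\<close> \<open>\<psi> 0 = 0\<close> assms(1) by auto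
    obtain s2 where s2: "T / 2 \<le> s2" "s2 \<le> T" "\<psi> s2 = y / 2"
      using IVT2'[of \<psi> T "y / 2" "T / 2"] cont \<open>0 < y\<close> \<open>\<psi> (T / 2) = y\<close> \<open>\<psi> T = 0\<close> assms(1) by auto
    have "s2 \<noteq> T" using s2 \<open>\<psi> T = 0\<close> \<open>0 < y\<close> by auto
    moreover have "\<sigma> * (\<phi> s1 - \<phi> 0) = \<sigma> * (\<phi> s2 - \<phi> 0)" using s1(3) s2(3) by (simp only: \<psi>_def)
    then have "\<phi> s1 = \<phi> s2" using \<open>\<sigma> \<noteq> 0\<close> by simp
    ultimately have "s1 = s2" using inj_onD[OF assms(4)] s1 s2 assms(1) by auto
    then have "s1 = T / 2" using s1 s2 by simp
    then have "y = y / 2" using s1(3) \<open>\<psi> (T / 2) = y\<close> by metis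
    then show False using \<open>0 < y\<close> by simp
  qed
  moreover have "\<not> 2 \<le> n"
  proof
    assume "2 \<le> n"
    then have "2 * L \<le> of_int n * L" using assms(2) by (intro mult_right_mono) auto
    then obtain s where "0 \<le> s" "s \<le> T" "\<phi> s = \<phi> 0 + L"
      using IVT'[of \<phi> 0 "\<phi> 0 + L" T] assms(1,2,3,5) by auto
    moreover from this have "s \<noteq> 0" "s \<noteq> T"
      using assms(2,5) \<open>2 * L \<le> of_int n * L\<close> by auto
    ultimately show False using ne[of s 1] by simp
  qed
  moreover have "\<not> n \<le> - 2"
  proof
    assume "n \<le> - 2"
    then have "of_int n * L \<le> - 2 * L" using assms(2) by (intro mult_right_mono) auto
    then obtain s where "0 \<le> s" "s \<le> T" "\<phi> s = \<phi> 0 - L"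
      using IVT2'[of \<phi> T "\<phi> 0 - L" 0] assms(1,2,3,5) by auto
    moreover from this have "s \<noteq> 0" "s \<noteq> T"
      using assms(2,5) \<open>of_int n * L \<le> - 2 * L\<close> by auto
    ultimately show False using ne[of s "- 1"] by simp
  qed
  ultimately have "n = 1 \<or> n = - 1" by linarith
  then show ?thesis using assms(5) by auto
qed

section \<open>Lifting curves in the loop to the parameter line\<close>

context unit_speed_loop
begin

text \<open>The map \<open>E\<close> identifies \<open>M\<close> with the unit circle by sending
  \<open>c t\<close> to \<open>cis (k * t)\<close>. Along \<open>g\<close> it has a continuous
  logarithm because the line is contractible, and the imaginary part divided by \<open>k\<close> is
  the lift.\<close>

lemma continuous_lift:
  fixes g :: "real \<Rightarrow> complex"
  assumes "continuous_on UNIV g" "range g \<subseteq> M"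
  obtains \<phi> where "continuous_on UNIV \<phi>" "\<And>t. g t = c (\<phi> t)"
proof -
  define k where "k = 2 * pi / L"
  define E where "E y = cis (k * the_inv_into {0..<L} c y)" for y
  have inj: "inj_on c {0..<L}" using par unfolding closed_parametrization_def by simp
  have E_c: "E (c t) = cis (k * t)" for t
  proof -
    obtain n :: int where n: "t + of_int n * L \<in> {0..<0 + L}" using translate_into_period[OF L_pos] .
    have "the_inv_into {0..<L} c (c t) = t + of_int n * L"
      using the_inv_into_f_f[OF inj, of "t + of_int n * L"] n periodic by simp
    moreover have "k * (t + of_int n * L) = k * t + 2 * pi * of_int n"
      using L_pos by (simp add: k_def field_simps)
    ultimately show ?thesis by (simp add: E_def cis_multiple_2pi flip: cis_mult)
  qed
  \<comment> \<open>The function \<open>the_inv_into {0..<L} c\<close> jumps at \<open>c 0\<close>,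
    but by a full period, which \<open>cis\<close> does not see. Near \<open>c t0\<close> the chart
    \<open>F\<close> can therefore stand in for it.\<close>
  have E_cont: "continuous_on M E"
  proof (clarsimp simp: continuous_on_eq_continuous_within continuous_within)
    fix y assume "y \<in> M"
    then obtain t0 where t0: "y = c t0" using obtain_parameter by blast
    obtain U F where UF: "open U" "c t0 \<in> U" "\<And>y. y \<in> U \<inter> M \<Longrightarrow> c (F y) = y"
      "\<forall>\<^sub>F t in nhds t0. F (c t) = t" "(F has_derivative (\<lambda>x. x \<bullet> c' t0)) (at (c t0))"
      by (rule local_chart[of t0]) blast
    have "F (c t0) = t0" using eventually_nhds_x_imp_x[OF UF(4)] .
    have "isCont F (c t0)" using UF(5) by (rule has_derivative_continuous)
    then have "(F \<longlongrightarrow> t0) (at y within M)"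
      unfolding t0 using \<open>F (c t0) = t0\<close> by (metis continuous_at_imp_continuous_at_within continuous_within)
    then have "((\<lambda>y. cis (k * F y)) \<longlongrightarrow> cis (k * t0)) (at y within M)"
      by (auto simp: cis_conv_exp intro!: tendsto_intros)
    moreover have "\<forall>\<^sub>F y in at y within M. cis (k * F y) = E y"
      unfolding eventually_at_topological using UF(1,2,3) E_c t0 by (metis IntI)
    ultimately show "(E \<longlongrightarrow> E y) (at y within M)"
      unfolding t0 E_c by (rule Lim_transform_eventually)
  qed
  have "continuous_on UNIV (\<lambda>t. E (g t))"
    using continuous_on_compose2[OF E_cont assms(1)] assms(2) by auto
  then obtain G where G: "continuous_on UNIV G" "\<And>t. E (g t) = exp (G t)"
    using continuous_logarithm_on_contractible[of UNIV "\<lambda>t. E (g t)"]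
    by (auto simp: E_def convex_imp_contractible)
  show thesis
  proof
    show "continuous_on UNIV (\<lambda>t. Im (G t) / k)"
      using L_pos by (auto intro!: continuous_intros G(1) simp: k_def)
    fix t
    obtain s where s: "g t = c s" using assms(2) obtain_parameter by (metis rangeI subsetD)
    have "exp (G t) = exp (\<i> * complex_of_real (k * s))"
      using G(2)[of t] E_c[of s] unfolding s cis_conv_exp by simp
    then obtain n :: int where "G t = \<i> * complex_of_real (k * s) + (of_int (2 * n) * pi) * \<i>"
      unfolding exp_eq by blast
    then have "Im (G t) = k * s + 2 * pi * of_int n" by simp
    then have "Im (G t) / k = s + of_int n * L"
      using L_pos by (simp add: k_def field_simps)
    then show "g t = c (Im (G t) / k)" using s periodic by simp
  qed
qed

text \<open>Near \<open>t\<close> the lift is the chart applied to \<open>g\<close>, so it inherits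
  differentiability from \<open>g\<close>. Differentiating \<open>c (\<phi> s)\<close> in turn shows
  that the velocity of \<open>g\<close> is tangent to the loop.\<close>

lemma lift_deriv:
  assumes "isCont \<phi> t" "\<And>s. g s = c (\<phi> s)" "(g has_vector_derivative v) (at t)"
  shows "(\<phi> has_real_derivative v \<bullet> c' (\<phi> t)) (at t)" "v = (v \<bullet> c' (\<phi> t)) *\<^sub>R c' (\<phi> t)"
proof -
  obtain U F where F: "\<forall>\<^sub>F s in nhds (\<phi> t). F (c s) = s"
      "(F has_derivative (\<lambda>x. x \<bullet> c' (\<phi> t))) (at (c (\<phi> t)))"
    by (rule local_chart[of "\<phi> t"]) blast
  have "\<forall>\<^sub>F s in nhds t. F (c (\<phi> s)) = \<phi> s"
    using eventually_compose_filterlim[OF F(1)] assms(1) by (simp add: continuous_at_imp_continuous_at_within isCont_def tendsto_at_iff_tendsto_nhds)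
  moreover have "((\<lambda>s. F (g s)) has_vector_derivative v \<bullet> c' (\<phi> t)) (at t)"
    using has_derivative_compose[OF assms(3)[unfolded has_vector_derivative_def] F(2)[folded assms(2)]]
    by (simp add: has_vector_derivative_def)
  ultimately show d: "(\<phi> has_real_derivative v \<bullet> c' (\<phi> t)) (at t)"
    unfolding has_real_derivative_iff_has_vector_derivative assms(2)
    using has_vector_derivative_cong_ev[where x = t and S = UNIV and f = "\<lambda>s. F (c (\<phi> s))" and g = \<phi>] eventually_nhds_x_imp_x by force
  have "(g has_vector_derivative (v \<bullet> c' (\<phi> t)) *\<^sub>R c' (\<phi> t)) (at t)"
    using vector_diff_chain_at[OF d[unfolded has_real_derivative_iff_has_vector_derivative] deriv]
    by (simp add: assms(2)[abs_def] o_def)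
  then show "v = (v \<bullet> c' (\<phi> t)) *\<^sub>R c' (\<phi> t)"
    using assms(3) vector_derivative_unique_at by blast
qed

lemma lift_degree:
  fixes \<phi> :: "real \<Rightarrow> real"
  assumes "continuous_on UNIV \<phi>" "\<And>s. g s = c (\<phi> s)" "0 < T" "g T = g 0" "inj_on g {0..<T}"
  shows "\<phi> T = \<phi> 0 + L \<or> \<phi> T = \<phi> 0 - L"
proof -
  obtain n :: int where n: "\<phi> T = \<phi> 0 + of_int n * L"
    using assms(2,4) eq_iff by metis
  show ?thesis
  proof (rule degree_one_of_injective[where T = T and L = L and \<phi> = \<phi> and n = n, OF assms(3) L_pos _ _ n])
    show "continuous_on {0..T} \<phi>" using assms(1) continuous_on_subset by blast
    show "inj_on \<phi> {0..<T}" using assms(2,5) by (metis inj_on_def)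
    fix s m assume "0 < s" "s < T"
    then have "g s \<noteq> g 0" using inj_onD[OF assms(5), of s 0] assms(3) by auto
    then show "\<phi> s \<noteq> \<phi> 0 + of_int m * L" unfolding assms(2) eq_iff by blast
  qed
qed

text \<open>The independence of \<open>volume_integral\<close> from the parametrization and the
  comparison of orientations both rest on this. The derivative of the lift is continuous and never
  zero, so it has one sign, and the sign selects the direction of the winding.\<close>

lemma closed_parametrization_lift:
  assumes d: "closed_parametrization M T d"
  obtains \<phi> \<phi>' where "continuous_on UNIV \<phi>" "\<And>t. d t = c (\<phi> t)"
    "\<And>t. (\<phi> has_real_derivative \<phi>' t) (at t)" "\<And>t. vector_derivative d (at t) = \<phi>' t *\<^sub>R c' (\<phi> t)"
    "(\<forall>t. 0 < \<phi>' t) \<and> \<phi> T = \<phi> 0 + L \<or> (\<forall>t. \<phi>' t < 0) \<and> \<phi> T = \<phi> 0 - L"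
proof -
  note D = closed_parametrizationD[OF d]
  obtain \<phi> where \<phi>: "continuous_on UNIV \<phi>" "\<And>t. d t = c (\<phi> t)"
    using continuous_lift[OF D(4)] D(6) by blast
  have "isCont \<phi> t" for t using \<phi>(1) by (simp add: continuous_on_eq_continuous_at)
  define \<phi>' where "\<phi>' t = vector_derivative d (at t) \<bullet> c' (\<phi> t)" for t
  note lift = lift_deriv[OF \<open>isCont \<phi> _\<close> \<phi>(2) D(2), folded \<phi>'_def]
  have cont: "continuous_on UNIV \<phi>'"
    unfolding \<phi>'_def
    by (intro continuous_intros C_infinity_on_imp_continuous_on[OF D(3)] continuous_on_compose2[OF c'_cont \<phi>(1)]) auto
  have "\<phi>' t \<noteq> 0" for t using lift(2)[of t] D(8)[of t] by auto
  note sign = continuous_nonzero_constant_sign[OF cont this]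
  have "\<phi> 0 < \<phi> T" if "\<forall>t. 0 < \<phi>' t"
    using lift(1) that by (intro DERIV_pos_imp_increasing[OF D(1)]) blast
  moreover have "\<phi> T < \<phi> 0" if "\<forall>t. \<phi>' t < 0"
    using lift(1) that by (intro DERIV_neg_imp_decreasing[OF D(1)]) blast
  moreover have "\<phi> T = \<phi> 0 + L \<or> \<phi> T = \<phi> 0 - L"
  proof (rule lift_degree[OF \<phi> D(1)])
    show "d T = d 0" using D(5)[of 0 1] by simp
    show "inj_on d {0..<T}" using d unfolding closed_parametrization_def by simp
  qed
  ultimately have "(\<forall>t. 0 < \<phi>' t) \<and> \<phi> T = \<phi> 0 + L \<or> (\<forall>t. \<phi>' t < 0) \<and> \<phi> T = \<phi> 0 - L"
    using sign L_pos by force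
  then show thesis using that[OF \<phi> lift] by blast
qed

text \<open>The chart moves the curve \<open>d\<close> to the parameter line. Tangent vectors and
  tangent maps, defined through arbitrary curves, can thus be computed along \<open>c\<close>
  alone.\<close>

lemma curve_throughE:
  assumes "curve_through M (c t) v d"
  obtains \<theta> where "(\<theta> has_real_derivative v \<bullet> c' t) (at 0)" "\<theta> 0 = t" "\<forall>\<^sub>F s in nhds 0. d s = c (\<theta> s)"
proof -
  obtain e where e: "0 < e" "d ` {-e<..<e} \<subseteq> M" "d 0 = c t" "(d has_vector_derivative v) (at 0)"
    using assms unfolding curve_through_def by blast
  obtain U F where UF: "open U" "c t \<in> U" "\<And>y. y \<in> U \<inter> M \<Longrightarrow> c (F y) = y"
      "\<forall>\<^sub>F s in nhds t. F (c s) = s" "(F has_derivative (\<lambda>x. x \<bullet> c' t)) (at (c t))"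
    by (rule local_chart[of t]) blast
  show thesis
  proof
    show "((\<lambda>s. F (d s)) has_real_derivative v \<bullet> c' t) (at 0)"
      using has_derivative_compose[OF e(4)[unfolded has_vector_derivative_def] UF(5)[folded e(3)]]
      by (simp add: has_vector_derivative_def has_real_derivative_iff_has_vector_derivative)
    show "F (d 0) = t" using eventually_nhds_x_imp_x[OF UF(4)] e(3) by simp
    have "(d \<longlongrightarrow> d 0) (nhds 0)"
      using has_vector_derivative_continuous[OF e(4)] by (simp add: isCont_def tendsto_at_iff_tendsto_nhds)
    then have "\<forall>\<^sub>F s in nhds 0. d s \<in> U"
      using UF(1,2) e(3) topological_tendstoD by metis
    moreover have "\<forall>\<^sub>F s in nhds 0. s \<in> {-e<..<e}"
      using e(1) by (intro eventually_nhds_in_open) auto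
    ultimately show "\<forall>\<^sub>F s in nhds 0. d s = c (F (d s))"
      by eventually_elim (use UF(3) e(2) in force)
  qed
qed

lemma curve_through_c: "curve_through M (c t) (a *\<^sub>R c' t) (\<lambda>s. c (t + a * s))"
proof -
  have "C_n_on n {-1<..<1} (\<lambda>s. c (t + a * s))" for n
    by (rule C_n_on_compose_affine[where S = UNIV and l' = "\<lambda>s. a * s"])
      (use smooth in \<open>auto intro!: derivative_eq_intros simp: C_infinity_on_def\<close>)
  moreover have "((\<lambda>s. t + a * s) has_vector_derivative a) (at 0)"
    by (auto simp: has_vector_derivative_def intro!: derivative_eq_intros)
  from vector_diff_chain_at[OF this, of c "c' t"]
  have "((\<lambda>s. c (t + a * s)) has_vector_derivative a *\<^sub>R c' t) (at 0)"
    using deriv[of t] by (simp add: o_def)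
  ultimately show ?thesis
    unfolding curve_through_def by (auto simp: C_infinity_on_def intro!: exI[of _ 1])
qed

lemma tangent_space_eq: "tangent_space M (c t) = range (\<lambda>a. a *\<^sub>R c' t)"
proof (intro equalityI subsetI)
  fix v assume "v \<in> tangent_space M (c t)"
  then obtain d where d: "curve_through M (c t) v d" unfolding tangent_space_def by auto
  then obtain \<theta> where \<theta>: "(\<theta> has_real_derivative v \<bullet> c' t) (at 0)" "\<theta> 0 = t"
    "\<forall>\<^sub>F s in nhds 0. d s = c (\<theta> s)" by (rule curve_throughE)
  have "((\<lambda>s. c (\<theta> s)) has_vector_derivative (v \<bullet> c' t) *\<^sub>R c' t) (at 0)"
    using vector_diff_chain_at[OF \<theta>(1)[unfolded has_real_derivative_iff_has_vector_derivative] deriv]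
    by (simp add: \<theta>(2) o_def)
  then have "(d has_vector_derivative (v \<bullet> c' t) *\<^sub>R c' t) (at 0)"
    using has_vector_derivative_cong_ev[where x = 0 and S = UNIV and f = d and g = "\<lambda>s. c (\<theta> s)"] \<theta>(3) eventually_nhds_x_imp_x by force
  then have "v = (v \<bullet> c' t) *\<^sub>R c' t"
    using d vector_derivative_unique_at unfolding curve_through_def by blast
  then show "v \<in> range (\<lambda>a. a *\<^sub>R c' t)" by blast
next
  fix v assume "v \<in> range (\<lambda>a. a *\<^sub>R c' t)"
  then show "v \<in> tangent_space M (c t)" using curve_through_c unfolding tangent_space_def by blast
qed

lemma induced_metric_eq: "induced_metric M (c t) (a *\<^sub>R c' t) (b *\<^sub>R c' t) = a * b"
  using c'_inner_self by (auto simp: induced_metric_def tangent_space_eq)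

text \<open>Differentiability of \<open>h\<close> along \<open>c\<close> suffices, since each
  competing curve is \<open>c\<close> after some \<theta> near 0. Uniqueness in \<open>THE\<close>
  takes at least one such curve, which \<open>curve_through_c\<close> supplies.\<close>

lemma tangent_map_eq:
  assumes "((\<lambda>s. h (c s)) has_vector_derivative u) (at t)"
  shows "tangent_map M h (c t) (a *\<^sub>R c' t) = a *\<^sub>R u"
proof -
  have *: "((\<lambda>s. h (d s)) has_vector_derivative a *\<^sub>R u) (at 0)"
    if d: "curve_through M (c t) (a *\<^sub>R c' t) d" for d
  proof -
    obtain \<theta> where "(\<theta> has_real_derivative (a *\<^sub>R c' t) \<bullet> c' t) (at 0)"
      and \<theta>: "\<theta> 0 = t" "\<forall>\<^sub>F s in nhds 0. d s = c (\<theta> s)"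
      by (rule curve_throughE[OF d])
    then have \<theta>_deriv: "(\<theta> has_real_derivative a) (at 0)" by (simp add: c'_inner_self)
    have "((\<lambda>s. h (c (\<theta> s))) has_vector_derivative a *\<^sub>R u) (at 0)"
      using vector_diff_chain_at[OF \<theta>_deriv[unfolded has_real_derivative_iff_has_vector_derivative],
          of "\<lambda>s. h (c s)" u] assms by (simp add: \<theta>(1) o_def)
    moreover have ev: "\<forall>\<^sub>F s in nhds 0. h (d s) = h (c (\<theta> s))"
      using \<theta>(2) by (rule eventually_mono) simp
    ultimately show ?thesis
      using has_vector_derivative_cong_ev[where x = 0 and S = UNIV and f = "\<lambda>s. h (d s)" and g = "\<lambda>s. h (c (\<theta> s))"]
        eventually_nhds_x_imp_x[OF ev] by (auto elim: eventually_mono)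
  qed
  show ?thesis
    unfolding tangent_map_def
    by (rule the_equality) (use * curve_through_c vector_derivative_unique_at in blast)+
qed

lemma tensor_metric_eq:
  assumes "\<And>a. B (c t) (a *\<^sub>R c' t) (a *\<^sub>R c' t) = a\<^sup>2 * b"
  shows "tensor_metric M (c t) B B = b\<^sup>2"
  unfolding tensor_metric_def
proof (rule the_equality)
  have *: "b\<^sup>2 = B (c t) X X * B (c t) X X * (inverse (induced_metric M (c t) X X))\<^sup>2"
    if X: "X \<in> tangent_space M (c t) - {0}" for X
  proof -
    obtain a where "X = a *\<^sub>R c' t" using X by (auto simp: tangent_space_eq)
    moreover from this have "a \<noteq> 0" using X by auto
    ultimately show ?thesis by (simp add: assms induced_metric_eq field_simps power2_eq_square)
  qed
  then show "\<forall>X\<in>tangent_space M (c t) - {0}.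
    b\<^sup>2 = B (c t) X X * B (c t) X X * (inverse (induced_metric M (c t) X X))\<^sup>2" by blast
  \<comment> \<open>Without a nonzero tangent vector every \<open>r\<close> would satisfy the
    condition under \<open>THE\<close>.\<close>
  have "c' t \<in> tangent_space M (c t) - {0}"
    using unit[of t] tangent_space_eq[of t] by (metis DiffI norm_zero rangeI scaleR_one singletonD zero_neq_one)
  then show "r = b\<^sup>2" if "\<forall>X\<in>tangent_space M (c t) - {0}.
    r = B (c t) X X * B (c t) X X * (inverse (induced_metric M (c t) X X))\<^sup>2" for r
    using that * by metis
qed

lemma volume_integral_eq:
  assumes f: "continuous_on UNIV (\<lambda>t. f (c t))"
  shows "volume_integral M f = integral {0..L} (\<lambda>t. f (c t))"
proof -
  let ?I = "integral {0..L} (\<lambda>t. f (c t))"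
  define J where "J d T I \<longleftrightarrow> ((\<lambda>t. f (d t) * sqrt (induced_metric M (d t)
            (vector_derivative d (at t)) (vector_derivative d (at t)))) has_integral I) {0..T}" for d T I
  have period: "integral {a..a + L} (\<lambda>t. f (c t)) = ?I" for a
    by (rule integral_over_period[OF f _ L_pos]) (use periodic[of _ 1] in simp)
  have J: "J d T ?I" if d: "closed_parametrization M T d" for d T
  proof -
    note D = closed_parametrizationD[OF d]
    let ?d = "\<lambda>t. vector_derivative d (at t)"
    obtain \<phi> p where \<phi>: "continuous_on UNIV \<phi>" "\<And>t. d t = c (\<phi> t)"
      and lift: "\<And>t. (\<phi> has_real_derivative p t) (at t)" "\<And>t. ?d t = p t *\<^sub>R c' (\<phi> t)"
      and sign: "(\<forall>t. 0 < p t) \<and> \<phi> T = \<phi> 0 + L \<or> (\<forall>t. p t < 0) \<and> \<phi> T = \<phi> 0 - L"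
      by (rule closed_parametrization_lift[OF d]) blast
    have speed: "sqrt (induced_metric M (d t) (?d t) (?d t)) = \<bar>p t\<bar>" for t
      using induced_metric_eq[of "\<phi> t" "p t" "p t"] by (simp add: lift(2)[symmetric] \<phi>(2)[symmetric])
    obtain a b where ab: "\<phi> ` {0..T} \<subseteq> {a..b}"
      using compact_continuous_image[OF continuous_on_subset[OF \<phi>(1) subset_UNIV] compact_Icc]
      by (metis bounded_subset_cbox_symmetric cbox_interval compact_imp_bounded)
    \<comment> \<open>Exactly one of the two intervals is nonempty, so the difference is an integral
      over one period with the sign of the direction of travel. The absolute value in
      \<open>speed\<close> removes that sign.\<close>
    have sub: "((\<lambda>t. p t *\<^sub>R f (c (\<phi> t))) has_integral
        integral {\<phi> 0..\<phi> T} (\<lambda>t. f (c t)) - integral {\<phi> T..\<phi> 0} (\<lambda>t. f (c t))) {0..T}"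
      by (rule has_integral_substitution_general[of "{}", OF _ _ ab])
        (use D(1) in \<open>auto intro!: DERIV_subset[OF lift(1)] continuous_on_subset[OF f] continuous_on_subset[OF \<phi>(1)]\<close>)
    from sign show ?thesis
    proof (elim disjE conjE)
      assume "\<forall>t. 0 < p t" "\<phi> T = \<phi> 0 + L"
      then show ?thesis
        using sub period[of "\<phi> 0"] L_pos unfolding J_def speed by (simp add: \<phi>(2) mult.commute abs_of_pos)
    next
      assume "\<forall>t. p t < 0" "\<phi> T = \<phi> 0 - L"
      then show ?thesis
        using has_integral_neg[OF sub] period[of "\<phi> T"] L_pos unfolding J_def speed
        by (simp add: \<phi>(2) mult.commute abs_of_neg)
    qed
  qed
  show ?thesis
    unfolding volume_integral_def J_def[symmetric]
  proof (rule the_equality)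
    fix I assume "\<forall>T d. closed_parametrization M T d \<longrightarrow> J d T I"
    then show "I = ?I" using J[OF par] par has_integral_unique unfolding J_def by blast
  qed (use J in blast)
qed

end

subsection \<open>The energy of a lift\<close>

text \<open>With \<open>f s = (s\<^sup>2 - 1)\<^sup>2\<close> one has
  \<open>f s = f r + f' r * (s - r) + (s - r)\<^sup>2 * ((s + r)\<^sup>2 + 2 * (r\<^sup>2 - 1))\<close>. So for \<open>r \<ge> 1\<close> the graph
  of \<open>f\<close> lies above its tangent at \<open>r\<close>, even though \<open>f\<close> is not convex.\<close>

lemma double_well_energy:
  fixes \<phi> \<phi>' :: "real \<Rightarrow> real"
  assumes "0 < L" "1 \<le> r" and deriv: "\<And>t. (\<phi> has_real_derivative \<phi>' t) (at t)"
    and cont: "continuous_on UNIV \<phi>'" and "\<phi> 0 = 0" "\<phi> L = r * L"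
  defines "E \<equiv> integral {0..L} (\<lambda>t. ((\<phi>' t)\<^sup>2 - 1)\<^sup>2)"
  shows "L * (r\<^sup>2 - 1)\<^sup>2 \<le> E"
    and "E \<le> L * (r\<^sup>2 - 1)\<^sup>2 \<Longrightarrow> t \<in> {0..L} \<Longrightarrow> \<phi> t = r * t"
proof -
  define R where "R t = (\<phi>' t - r)\<^sup>2 * ((\<phi>' t + r)\<^sup>2 + 2 * (r\<^sup>2 - 1))" for t
  have r2: "1 \<le> r\<^sup>2" using assms(2) by (simp add: one_le_power)
  have R_nonneg: "0 \<le> R t" for t
    unfolding R_def using r2 by (intro mult_nonneg_nonneg add_nonneg_nonneg) auto
  have \<phi>'_cont: "continuous_on {0..L} \<phi>'" using cont continuous_on_subset by blast
  have R_cont: "continuous_on {0..L} R"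
    unfolding R_def by (intro continuous_intros \<phi>'_cont)
  have int_R: "R integrable_on {0..L}" by (rule integrable_continuous_interval[OF R_cont])
  have FTC: "(\<phi>' has_integral r * x) {0..x}" if "0 \<le> x" "\<phi> x = r * x" for x
    using fundamental_theorem_of_calculus[OF that(1), of \<phi> \<phi>'] deriv that(2) assms(5)
    by (simp add: has_real_derivative_iff_has_vector_derivative has_vector_derivative_at_within)
  have lin: "((\<lambda>t. \<phi>' t - r) has_integral 0) {0..L}"
    using has_integral_diff[OF FTC[of L] has_integral_const_real[of r 0 L]] assms(1,6)
    by (simp add: mult.commute)
  have "((\<lambda>t. (r\<^sup>2 - 1)\<^sup>2 + 4 * r * (r\<^sup>2 - 1) * (\<phi>' t - r) + R t) has_integral
      L * (r\<^sup>2 - 1)\<^sup>2 + 4 * r * (r\<^sup>2 - 1) * 0 + integral {0..L} R) {0..L}"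
    using has_integral_const_real[of "(r\<^sup>2 - 1)\<^sup>2" 0 L] assms(1)
    by (intro has_integral_add has_integral_mult_right lin integrable_integral int_R) auto
  moreover have "(r\<^sup>2 - 1)\<^sup>2 + 4 * r * (r\<^sup>2 - 1) * (\<phi>' t - r) + R t = ((\<phi>' t)\<^sup>2 - 1)\<^sup>2" for t
    unfolding R_def by (simp add: power2_eq_square algebra_simps)
  ultimately have E: "E = L * (r\<^sup>2 - 1)\<^sup>2 + integral {0..L} R"
    unfolding E_def by (simp add: integral_unique)
  then show "L * (r\<^sup>2 - 1)\<^sup>2 \<le> E"
    using integral_nonneg[OF int_R] R_nonneg by simp
  assume "E \<le> L * (r\<^sup>2 - 1)\<^sup>2" and t: "t \<in> {0..L}"
  then have "integral {0..L} R = 0"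
    using E integral_nonneg[OF int_R R_nonneg] by linarith
  then have R0: "R s = 0" if "s \<in> {0..L}" for s
    using integral_eq_0_iff[OF R_cont assms(1)] R_nonneg that by blast
  \<comment> \<open>\<open>R s = 0\<close> does not yield \<open>\<phi>' s = r\<close> at once: for
    \<open>r = 1\<close> the second factor also vanishes at \<open>\<phi>' s = - 1\<close>. Values
    above \<open>r\<close> are excluded, however, and since \<open>r - \<phi>'\<close> has integral
    zero this is enough.\<close>
  have "\<phi>' s \<le> r" if "s \<in> {0..L}" for s
  proof (rule ccontr)
    assume "\<not> \<phi>' s \<le> r"
    then have "0 < (\<phi>' s - r)\<^sup>2" "0 < (\<phi>' s + r)\<^sup>2" using assms(2) by auto
    then have "0 < R s" unfolding R_def using r2 by (intro mult_pos_pos add_pos_nonneg) auto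
    then show False using R0[OF that] by simp
  qed
  moreover have "integral {0..L} (\<lambda>s. r - \<phi>' s) = 0"
    using integral_unique[OF has_integral_neg[OF lin]] by simp
  moreover have "continuous_on {0..L} (\<lambda>s. r - \<phi>' s)"
    by (intro continuous_intros \<phi>'_cont)
  ultimately have "\<phi>' s = r" if "s \<in> {0..L}" for s
    using integral_eq_0_iff[of 0 L "\<lambda>s. r - \<phi>' s"] assms(1) that by simp
  then have "((\<lambda>s. \<phi> s - r * s) has_real_derivative 0) (at s within {0..L})" if "s \<in> {0..L}" for s
    using that DERIV_subset[OF deriv[of s]] by (auto intro!: derivative_eq_intros)
  then obtain C where C: "\<And>s. s \<in> {0..L} \<Longrightarrow> \<phi> s - r * s = C"
    using has_field_derivative_zero_constant[of "{0..L}" "\<lambda>s. \<phi> s - r * s"] by auto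
  show "\<phi> t = r * t" using C[OF t] C[of 0] assms(1,5) by simp
qed

section \<open>Smooth maps along a loop, and orientation via winding numbers\<close>

context unit_speed_loop
begin

lemma smooth_map_along_curve:
  fixes h :: "complex \<Rightarrow> complex"
  assumes "smooth_map M h"
  shows "((\<lambda>s. h (c s)) has_vector_derivative vector_derivative (\<lambda>s. h (c s)) (at t)) (at t)"
    and "continuous_on UNIV (\<lambda>t. vector_derivative (\<lambda>s. h (c s)) (at t))"
proof -
  let ?g = "\<lambda>s. h (c s)"
  have *: "(?g has_vector_derivative vector_derivative ?g (at t)) (at t) \<and>
      isCont (\<lambda>t. vector_derivative ?g (at t)) t" for t
  proof -
    obtain U F where UF: "open U" "c t \<in> U" "C_infinity_on U F" "\<And>y. y \<in> U \<inter> M \<Longrightarrow> F y = h y"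
      using assms in_M unfolding smooth_map_def by metis
    define V where "V = c -` U"
    have V: "open V" "t \<in> V" using UF(1,2) cont by (auto simp: V_def open_vimage)
    have "C_n_on (Suc 0) U F" using UF(3) unfolding C_infinity_on_def by blast
    note F = C_n_on_SucE[OF this]
    let ?F = "\<lambda>s. frechet_derivative F (at (c s))"
    have d: "(?g has_vector_derivative ?F s (c' s)) (at s)" if "s \<in> V" for s
    proof -
      have "((\<lambda>s. F (c s)) has_vector_derivative ?F s (c' s)) (at s)"
        using vector_derivative_diff_chain_within[OF deriv[of s], of F "?F s"] F(1)[of "c s"] that
        by (auto simp: V_def o_def intro: has_derivative_at_withinI)
      then show ?thesis
        by (rule has_vector_derivative_transform_within_open[OF _ V(1) that]) (use UF(4) in \<open>auto simp: V_def\<close>)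
    qed
    \<comment> \<open>\<open>C_n_on\<close> gives continuity of the derivative of \<open>F\<close>
      in a fixed direction, while \<open>c' s\<close> moves with \<open>s\<close>. Expanding in the
      basis 1, \<i> reduces to fixed directions.\<close>
    have eq: "vector_derivative ?g (at s) = Re (c' s) *\<^sub>R ?F s 1 + Im (c' s) *\<^sub>R ?F s \<i>" if "s \<in> V" for s
    proof -
      have lin: "linear (?F s)" using F(1)[of "c s"] that has_derivative_linear by (auto simp: V_def)
      have "c' s = Re (c' s) *\<^sub>R 1 + Im (c' s) *\<^sub>R \<i>" by (simp add: complex_eq_iff)
      then have "?F s (c' s) = Re (c' s) *\<^sub>R ?F s 1 + Im (c' s) *\<^sub>R ?F s \<i>"
        using linear_add[OF lin] linear_scale[OF lin] by metis
      then show ?thesis using vector_derivative_at[OF d[OF that]] by simp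
    qed
    have "continuous_on V (\<lambda>s. ?F s v)" for v
      using continuous_on_compose2[of U "\<lambda>x. frechet_derivative F (at x) v" V c] F(2)[of v]
        continuous_on_subset[OF cont] by (auto simp: V_def)
    then have "continuous_on V (\<lambda>s. Re (c' s) *\<^sub>R ?F s 1 + Im (c' s) *\<^sub>R ?F s \<i>)"
      by (intro continuous_intros continuous_on_subset[OF c'_cont]) auto
    then have "continuous_on V (\<lambda>t. vector_derivative ?g (at t))"
      by (rule continuous_on_eq) (simp add: eq)
    then show ?thesis
      using d[OF V(2)] V continuous_on_eq_continuous_at vector_derivative_at by metis
  qed
  then show "(?g has_vector_derivative vector_derivative ?g (at t)) (at t)"
    "continuous_on UNIV (\<lambda>t. vector_derivative ?g (at t))"
    by (auto intro: continuous_at_imp_continuous_on)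
qed

text \<open>\<open>positively_oriented\<close> quantifies over \<open>inside M\<close> and would be
  vacuous if that set were empty. The Jordan curve theorem supplies a point at which winding numbers
  can be compared.\<close>

lemma inside_nonempty: "inside M \<noteq> {}"
proof -
  let ?g = "\<lambda>s. c (L * s)"
  have "path_image ?g = c ` ((*) L ` {0..1})" by (simp add: path_image_def image_image)
  also have "\<dots> = c ` {0..L}" using L_pos by (simp add: image_mult_atLeastAtMost)
  also have "\<dots> = M"
  proof (intro equalityI subsetI)
    fix y assume "y \<in> M"
    then obtain t where "y = c t" "t \<in> {0..<0 + L}" by (rule obtain_parameter)
    then show "y \<in> c ` {0..L}" by auto
  qed auto
  finally have image: "path_image ?g = M" .
  have "loop_free ?g"
    unfolding loop_free_def
  proof (intro ballI impI)
    fix x y :: real assume xy: "x \<in> {0..1}" "y \<in> {0..1}" "c (L * x) = c (L * y)"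
    then obtain n :: int where "L * x = L * y + of_int n * L" using eq_iff by blast
    then have "L * x = L * (y + of_int n)" by (simp add: algebra_simps)
    then have n: "x = y + of_int n" unfolding mult_cancel_left using L_pos by simp
    then have "- 1 \<le> real_of_int n" "real_of_int n \<le> 1" using xy by auto
    then have "n = - 1 \<or> n = 0 \<or> n = 1" by linarith
    then show "x = y \<or> x = 0 \<and> y = 1 \<or> x = 1 \<and> y = 0" using n xy by auto
  qed
  moreover have "path ?g"
    unfolding path_def by (intro continuous_on_compose2[OF cont] continuous_intros) auto
  moreover have "pathfinish ?g = pathstart ?g"
    using periodic[of 0 1] by (simp add: pathfinish_def pathstart_def)
  ultimately show ?thesis
    using Jordan_inside_outside[of ?g] image by (simp add: simple_path_def)
qed

text \<open>A parametrization that runs against \<open>c\<close> is homotopic to the reverse of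
  \<open>c\<close> inside \<open>M\<close>, so its winding number about an inside point is - 1
  instead of 1.\<close>

lemma positively_oriented_direction:
  assumes "positively_oriented M L c" "closed_parametrization M T d" "positively_oriented M T d"
  obtains s a where "d t = c s" "0 < a" "vector_derivative d (at t) = a *\<^sub>R c' s"
proof -
  obtain \<phi> p where \<phi>: "continuous_on UNIV \<phi>" "\<And>t. d t = c (\<phi> t)"
    and lift: "\<And>t. vector_derivative d (at t) = p t *\<^sub>R c' (\<phi> t)"
    and sign: "(\<forall>t. 0 < p t) \<and> \<phi> T = \<phi> 0 + L \<or> (\<forall>t. p t < 0) \<and> \<phi> T = \<phi> 0 - L"
    by (rule closed_parametrization_lift[OF assms(2)]) blast
  from sign show thesis
  proof (elim disjE conjE)
    assume "\<forall>t. 0 < p t"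
    then show thesis using that \<phi>(2) lift by blast
  next
    assume \<phi>T: "\<phi> T = \<phi> 0 - L"
    obtain z where z: "z \<in> inside M" using inside_nonempty by blast
    then have "z \<notin> M" using inside_no_overlap[of M] by blast
    let ?c = "\<lambda>s. c (L * s)" and ?e = "\<lambda>s. d (T * s)"
    \<comment> \<open>The interpolation takes place on the parameter line, between \<phi> (T * s)
      and L * (1 - s), and \<open>c\<close> carries it into \<open>M\<close>, away from
      \<open>z\<close>. Intermediate paths close up because both parameters drop by exactly
      \<open>L\<close>.\<close>
    define H where "H = (\<lambda>x. c ((1 - fst x) * \<phi> (T * snd x) + fst x * (L * (1 - snd x))))"
    have "homotopic_loops (- {z}) ?e (reversepath ?c)"
      unfolding homotopic_loops
    proof (intro exI[of _ H] conjI ballI)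
      show "continuous_on ({0..1} \<times> {0..1}) H"
        unfolding H_def by (intro continuous_on_compose2[OF cont] continuous_on_compose2[OF \<phi>(1)] continuous_intros) auto
      show "H \<in> {0..1} \<times> {0..1} \<rightarrow> - {z}"
        using \<open>z \<notin> M\<close> in_M unfolding H_def by (metis (no_types, lifting) ComplI Pi_I singletonD)
      fix s :: real
      show "pathfinish (H \<circ> Pair s) = pathstart (H \<circ> Pair s)"
        using periodic[of "(1 - s) * \<phi> 0 + s * L" "- 1"]
        by (simp add: H_def pathfinish_def pathstart_def \<phi>T algebra_simps)
    qed (auto simp: H_def reversepath_def \<phi>(2))
    then have "winding_number ?e z = winding_number (reversepath ?c) z"
      by (rule winding_number_homotopic_loops)
    also have "\<dots> = - winding_number ?c z"
    proof (rule winding_number_reversepath)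
      show "path ?c"
        unfolding path_def by (intro continuous_on_compose2[OF cont] continuous_intros) auto
      show "z \<notin> path_image ?c" using \<open>z \<notin> M\<close> in_M unfolding path_image_def by blast
    qed
    finally have False
      using assms(1,3) z by (simp add: positively_oriented_def)
    then show thesis ..
  qed
qed

lemma positive_tangent_iff:
  assumes "positively_oriented M L c"
  shows "positive_tangent M x v \<longleftrightarrow> (\<exists>s a. x = c s \<and> 0 < a \<and> v = a *\<^sub>R c' s)"
proof
  assume "positive_tangent M x v"
  then obtain T d t b where d: "closed_parametrization M T d" "positively_oriented M T d"
    "d t = x" "0 < b" "v = b *\<^sub>R vector_derivative d (at t)"
    unfolding positive_tangent_def by blast
  obtain s a where "d t = c s" "0 < a" "vector_derivative d (at t) = a *\<^sub>R c' s"
    by (rule positively_oriented_direction[OF assms d(1,2)])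
  then have "x = c s \<and> 0 < b * a \<and> v = (b * a) *\<^sub>R c' s" using d by simp
  then show "\<exists>s a. x = c s \<and> 0 < a \<and> v = a *\<^sub>R c' s" by blast
next
  assume "\<exists>s a. x = c s \<and> 0 < a \<and> v = a *\<^sub>R c' s"
  then show "positive_tangent M x v" using assms par unfolding positive_tangent_def by metis
qed

end

subsection \<open>Maps between two loops\<close>

locale unit_speed_loops = M: unit_speed_loop M L c + N: unit_speed_loop N K k
  for M :: "complex set" and L :: real and c :: "real \<Rightarrow> complex"
    and N :: "complex set" and K :: real and k :: "real \<Rightarrow> complex"
begin

text \<open>Near \<open>c t0\<close> the chart provides the extension \<open>k (r * F y + b)\<close>
  to an open set of the plane.\<close>

lemma smooth_map_of_affine:
  assumes h: "\<And>t. h (c t) = k (r * t + b)"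
  shows "smooth_map M h"
  unfolding smooth_map_def
proof
  fix x assume "x \<in> M"
  then obtain t0 where x: "x = c t0" using M.obtain_parameter by blast
  obtain U F where UF: "open U" "c t0 \<in> U" "\<And>y. y \<in> U \<inter> M \<Longrightarrow> c (F y) = y"
    "\<And>G :: real \<Rightarrow> complex. C_infinity_on UNIV G \<Longrightarrow> C_infinity_on U (\<lambda>y. G (F y))"
    by (rule M.local_chart[of t0]) blast
  have "C_infinity_on UNIV (\<lambda>s. k (r * s + b))"
    unfolding C_infinity_on_def
  proof
    fix n
    show "C_n_on n UNIV (\<lambda>s. k (r * s + b))"
      by (rule C_n_on_compose_affine[where S = UNIV and l' = "\<lambda>s. r * s"])
        (use N.smooth in \<open>auto intro!: derivative_eq_intros simp: C_infinity_on_def\<close>)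
  qed
  moreover have "k (r * F y + b) = h y" if "y \<in> U \<inter> M" for y
    using h[of "F y"] UF(3)[OF that] by simp
  ultimately show "\<exists>U F. open U \<and> x \<in> U \<and> C_infinity_on U F \<and> (\<forall>y\<in>U \<inter> M. F y = h y)"
    using UF(1,2,4) x by blast
qed

text \<open>With this slope, multiplication by \<open>r\<close> carries the multiples of
  \<open>L\<close> onto those of \<open>K\<close>, whence injectivity. The inverse has slope
  \<open>1 / r\<close>, so its smoothness follows with the loops exchanged.\<close>

lemma Diff_of_affine:
  assumes h: "h \<in> extensional M" "\<And>t. h (c t) = k (r * t)" and r: "\<bar>r\<bar> = K / L"
  shows "h \<in> Diff M N"
proof -
  interpret swap: unit_speed_loops N K k M L c ..
  have "r \<noteq> 0" using r M.L_pos N.L_pos by auto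
  have "inj_on h M"
  proof (rule inj_onI)
    fix x y assume "x \<in> M" "y \<in> M" and eq: "h x = h y"
    then obtain s t where st: "x = c s" "y = c t" using M.obtain_parameter by metis
    then obtain n :: int where n: "r * s = r * t + of_int n * K" using eq h(2) N.eq_iff by auto
    have "K = \<bar>r\<bar> * L" using r M.L_pos by simp
    then have "K = r * L \<or> K = r * - L" by linarith
    then have "r * s = r * (t + of_int n * L) \<or> r * s = r * (t + of_int (- n) * L)"
      using n by (auto simp: algebra_simps)
    then have "s = t + of_int n * L \<or> s = t + of_int (- n) * L"
      unfolding mult_cancel_left using \<open>r \<noteq> 0\<close> by blast
    then show "x = y" unfolding st M.eq_iff by blast
  qed
  moreover have "h ` M = N"
  proof -
    have "k s = h (c (s / r))" for s using h(2) \<open>r \<noteq> 0\<close> by simp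
    then have "range k \<subseteq> h ` range c" by auto
    moreover have "h ` range c \<subseteq> range k" using h(2) by auto
    ultimately show ?thesis by (simp add: M.range N.range)
  qed
  moreover have inv: "the_inv_into M h (k s) = c (1 / r * s + 0)" for s
    using the_inv_into_f_f[OF \<open>inj_on h M\<close> M.in_M, of "s / r"] h(2) \<open>r \<noteq> 0\<close> by simp
  ultimately show ?thesis
    using h smooth_map_of_affine[of h r 0] swap.smooth_map_of_affine[OF inv]
    unfolding Diff_def bij_betw_def by simp
qed

lemma tangent_map_lift:
  assumes "\<And>s. h (c s) = k (\<phi> s)" "(\<phi> has_real_derivative u) (at t)"
  shows "tangent_map M h (c t) (a *\<^sub>R M.c' t) = (a * u) *\<^sub>R N.c' (\<phi> t)"
proof -
  have "((\<lambda>s. h (c s)) has_vector_derivative u *\<^sub>R N.c' (\<phi> t)) (at t)"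
    using vector_diff_chain_at[OF assms(2)[unfolded has_real_derivative_iff_has_vector_derivative] N.deriv]
    by (simp add: assms(1) o_def)
  from M.tangent_map_eq[OF this] show ?thesis by simp
qed

text \<open>In the unit speed parameter the metric of \<open>M\<close> has component 1 and the
  pull-back has component \<open>(\<phi>' t)\<^sup>2\<close>; the integrand is the square of their
  difference.\<close>

lemma deformation_energy_lift:
  assumes "\<And>s. h (c s) = k (\<phi> s)" "\<And>t. (\<phi> has_real_derivative \<phi>' t) (at t)" "continuous_on UNIV \<phi>'"
  shows "deformation_energy M N h = integral {0..L} (\<lambda>t. ((\<phi>' t)\<^sup>2 - 1)\<^sup>2)"
proof -
  define B where "B = (\<lambda>p u v. pullback M h (induced_metric N) p u v - induced_metric M p u v)"
  have "B (c t) (a *\<^sub>R M.c' t) (a *\<^sub>R M.c' t) = a\<^sup>2 * ((\<phi>' t)\<^sup>2 - 1)" for a t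
    unfolding B_def pullback_def
    by (simp add: tangent_map_lift[OF assms(1,2)] M.induced_metric_eq N.induced_metric_eq assms(1))
      (simp add: power2_eq_square algebra_simps)
  then have B: "tensor_metric M (c t) B B = ((\<phi>' t)\<^sup>2 - 1)\<^sup>2" for t
    by (rule M.tensor_metric_eq)
  have "volume_integral M (\<lambda>p. tensor_metric M p B B) = integral {0..L} (\<lambda>t. ((\<phi>' t)\<^sup>2 - 1)\<^sup>2)"
    by (subst M.volume_integral_eq) (auto simp: B intro!: continuous_intros assms(3))
  then show ?thesis unfolding deformation_energy_def Let_def B_def .
qed

lemma Diff_lift:
  assumes h: "h \<in> Diff M N" "h (c 0) = k 0"
  obtains \<phi> \<phi>' where "\<And>s. h (c s) = k (\<phi> s)" "\<And>t. (\<phi> has_real_derivative \<phi>' t) (at t)"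
    "continuous_on UNIV \<phi>'" "\<phi> 0 = 0" "\<phi> L = K \<or> \<phi> L = - K"
proof -
  let ?g = "\<lambda>t. h (c t)"
  have bij: "inj_on h M" "h ` M = N" and "smooth_map M h"
    using h(1) by (auto simp: Diff_def bij_betw_def)
  note g = M.smooth_map_along_curve[OF this(3)]
  have g_cont: "continuous_on UNIV ?g"
    by (intro continuous_at_imp_continuous_on ballI has_vector_derivative_continuous[OF g(1)])
  obtain \<theta> where \<theta>: "continuous_on UNIV \<theta>" "\<And>t. ?g t = k (\<theta> t)"
    by (rule N.continuous_lift[OF g_cont]) (use bij in auto)
  obtain n :: int where n: "\<theta> 0 = 0 + of_int n * K" using h(2) \<theta>(2) N.eq_iff by metis
  \<comment> \<open>A lift may be shifted by multiples of \<open>K\<close>; this one is normalized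
    to vanish at 0.\<close>
  define \<phi> where "\<phi> t = \<theta> t - of_int n * K" for t
  have \<phi>: "continuous_on UNIV \<phi>" unfolding \<phi>_def by (intro continuous_intros \<theta>(1))
  have lift: "?g s = k (\<phi> s)" for s
    using N.periodic[of "\<phi> s" n] \<theta>(2) by (simp add: \<phi>_def)
  have "isCont \<phi> t" for t using \<phi> by (simp add: continuous_on_eq_continuous_at)
  note d = N.lift_deriv(1)[OF this lift g(1)]
  have "inj_on ?g {0..<L}"
    using M.par bij(1) unfolding closed_parametrization_def inj_on_def by auto
  moreover have "?g L = ?g 0" using M.periodic[of 0 1] by simp
  ultimately have "\<phi> L = \<phi> 0 + K \<or> \<phi> L = \<phi> 0 - K"
    by (intro N.lift_degree[OF \<phi> lift M.L_pos])
  moreover have "\<phi> 0 = 0" by (simp add: \<phi>_def n)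
  moreover have "continuous_on UNIV (\<lambda>t. vector_derivative ?g (at t) \<bullet> N.c' (\<phi> t))"
    by (intro continuous_intros g(2) continuous_on_compose2[OF N.c'_cont \<phi>]) auto
  ultimately show thesis using that[OF lift d] by simp
qed

lemma deformation_energy_bound:
  assumes "L \<le> K" and h: "h \<in> Diff M N" "h (c 0) = k 0"
  shows "(K\<^sup>2 - L\<^sup>2)\<^sup>2 / L ^ 3 \<le> deformation_energy M N h"
    and "deformation_energy M N h \<le> (K\<^sup>2 - L\<^sup>2)\<^sup>2 / L ^ 3 \<Longrightarrow>
      (\<forall>t\<in>{0..L}. h (c t) = k (K / L * t)) \<or> (\<forall>t\<in>{0..L}. h (c t) = k (- (K / L) * t))"
proof -
  obtain \<phi> \<phi>' where \<phi>: "\<And>s. h (c s) = k (\<phi> s)" "\<And>t. (\<phi> has_real_derivative \<phi>' t) (at t)"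
    "continuous_on UNIV \<phi>'" "\<phi> 0 = 0" "\<phi> L = K \<or> \<phi> L = - K"
    by (rule Diff_lift[OF h]) blast
  \<comment> \<open>The energy is even in \<phi>', so a lift ending at \<open>- K\<close> may be
    reflected. One application of \<open>double_well_energy\<close> then serves both
    orientations.\<close>
  define \<sigma> :: real where "\<sigma> = (if \<phi> L = K then 1 else - 1)"
  have \<sigma>: "\<sigma> * \<phi> L = K" "\<sigma> = 1 \<or> \<sigma> = - 1"
    using \<phi>(5) by (auto simp: \<sigma>_def)
  have min: "L * ((K / L)\<^sup>2 - 1)\<^sup>2 = (K\<^sup>2 - L\<^sup>2)\<^sup>2 / L ^ 3"
    using M.L_pos by (simp add: field_simps power2_eq_square power3_eq_cube)
  have "(\<sigma> * x)\<^sup>2 = x\<^sup>2" for x using \<sigma>(2) by auto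
  then have E: "deformation_energy M N h = integral {0..L} (\<lambda>t. ((\<sigma> * \<phi>' t)\<^sup>2 - 1)\<^sup>2)"
    by (simp add: deformation_energy_lift[OF \<phi>(1-3)])
  have "1 \<le> K / L" using assms(1) M.L_pos by simp
  note energy = double_well_energy[OF M.L_pos this, of "\<lambda>t. \<sigma> * \<phi> t" "\<lambda>t. \<sigma> * \<phi>' t", folded E, unfolded min]
  have prems: "((\<lambda>t. \<sigma> * \<phi> t) has_real_derivative \<sigma> * \<phi>' t) (at t)"
    "continuous_on UNIV (\<lambda>t. \<sigma> * \<phi>' t)" "\<sigma> * \<phi> 0 = 0" "\<sigma> * \<phi> L = K / L * L" for t
    using DERIV_cmult[OF \<phi>(2)] continuous_on_mult_left[OF \<phi>(3)] \<phi>(4) \<sigma>(1) M.L_pos by simp_all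
  show "(K\<^sup>2 - L\<^sup>2)\<^sup>2 / L ^ 3 \<le> deformation_energy M N h"
    by (rule energy(1)[OF prems])
  assume "deformation_energy M N h \<le> (K\<^sup>2 - L\<^sup>2)\<^sup>2 / L ^ 3"
  then have "\<sigma> * \<phi> t = K / L * t" if "t \<in> {0..L}" for t
    using energy(2)[OF prems _ that] by blast
  then have "\<phi> t = \<sigma> * (K / L * t)" if "t \<in> {0..L}" for t
    using \<sigma>(2) that by (metis minus_minus mult_1 mult_minus1)
  then show "(\<forall>t\<in>{0..L}. h (c t) = k (K / L * t)) \<or> (\<forall>t\<in>{0..L}. h (c t) = k (- (K / L) * t))"
    using \<sigma>(2) \<phi>(1) by auto
qed

lemma deformation_energy_affine:
  assumes "\<And>t. h (c t) = k (r * t)" "\<bar>r\<bar> = K / L"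
  shows "deformation_energy M N h = (K\<^sup>2 - L\<^sup>2)\<^sup>2 / L ^ 3"
proof -
  have "deformation_energy M N h = integral {0..L} (\<lambda>t. (r\<^sup>2 - 1)\<^sup>2)"
    using deformation_energy_lift[of h "\<lambda>t. r * t" "\<lambda>_. r"] assms(1)
    by (auto intro!: derivative_eq_intros)
  also have "\<dots> = L * (r\<^sup>2 - 1)\<^sup>2" using M.L_pos by simp
  also have "r\<^sup>2 = (K / L)\<^sup>2" using assms(2) by (metis power2_abs)
  also have "L * ((K / L)\<^sup>2 - 1)\<^sup>2 = (K\<^sup>2 - L\<^sup>2)\<^sup>2 / L ^ 3"
    using M.L_pos by (simp add: field_simps power2_eq_square power3_eq_cube)
  finally show ?thesis .
qed

lemma extensional_eqI:
  assumes "h \<in> extensional M" "h' \<in> extensional M" "\<And>t. t \<in> {0..<L} \<Longrightarrow> h (c t) = h' (c t)"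
  shows "h = h'"
  by (rule extensionalityI[OF assms(1,2)]) (use M.obtain_parameter[of _ 0] assms(3) in \<open>metis add_0\<close>)

lemma orientation_of_affine:
  assumes "positively_oriented M L c" "positively_oriented N K k" "\<And>t. h (c t) = k (r * t)"
  shows "0 < r \<Longrightarrow> orientation_preserving M N h" "r < 0 \<Longrightarrow> orientation_reversing M N h"
proof -
  have "((\<lambda>t. r * t) has_real_derivative r) (at t)" for t
    by (auto intro!: derivative_eq_intros)
  note t = tangent_map_lift[of h "\<lambda>t. r * t", OF assms(3) this]
  show "orientation_preserving M N h" if "0 < r"
    unfolding orientation_preserving_def M.positive_tangent_iff[OF assms(1)] N.positive_tangent_iff[OF assms(2)]
    using that assms(3) t by (metis mult_pos_pos)
  show "orientation_reversing M N h" if "r < 0"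
    unfolding orientation_reversing_def M.positive_tangent_iff[OF assms(1)] N.positive_tangent_iff[OF assms(2)]
  proof (intro ballI allI impI, elim exE conjE)
    fix x v s a assume "x = c s" "0 < (a :: real)" "v = a *\<^sub>R M.c' s"
    then have "h x = k (r * s) \<and> 0 < a * - r \<and> - tangent_map M h x v = (a * - r) *\<^sub>R N.c' (r * s)"
      using that assms(3) t by (simp add: mult_pos_neg)
    then show "\<exists>s a. h x = k s \<and> 0 < a \<and> - tangent_map M h x v = a *\<^sub>R N.c' s" by blast
  qed
qed

end

text \<open>Only the values of \<gamma> on one closed period are specified, so the periodic
  \<open>c\<close> takes over. The orientation carries over because a winding number depends on the
  path only over the unit interval.\<close>

lemma arc_length_parametrizationE:
  assumes "arc_length_parametrization M \<gamma>"
  obtains c where "unit_speed_loop M (arc_length M) c" "\<And>t. t \<in> {0..arc_length M} \<Longrightarrow> \<gamma> t = c t"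
    "positively_oriented M (arc_length M) \<gamma> \<Longrightarrow> positively_oriented M (arc_length M) c"
proof -
  obtain c where c: "closed_parametrization M (arc_length M) c"
    "\<And>t. norm (vector_derivative c (at t)) = 1" "\<And>t. t \<in> {0..arc_length M} \<Longrightarrow> \<gamma> t = c t"
    using assms unfolding arc_length_parametrization_def by blast
  then have "unit_speed_loop M (arc_length M) c" by unfold_locales
  then interpret unit_speed_loop M "arc_length M" c .
  have "winding_number (\<lambda>s. \<gamma> (arc_length M * s)) z = winding_number (\<lambda>s. c (arc_length M * s)) z" for z
    using c(3) L_pos by (intro winding_number_cong) (auto simp: mult_left_le)
  then show thesis
    using that[OF \<open>unit_speed_loop M (arc_length M) c\<close> c(3)] by (simp add: positively_oriented_def)
qed

theorem proposition4p3:
  fixes M N :: "complex set" and p q :: complex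
    and \<gamma> \<xi> :: "real \<Rightarrow> complex" and v w :: "real \<Rightarrow> real"
    and h1 h2 :: "complex \<Rightarrow> complex"
  assumes M: "smooth_simple_closed_curve M" and N: "smooth_simple_closed_curve N"
    and p: "p \<in> M" and q: "q \<in> N"
    and \<gamma>: "arc_length_parametrization M \<gamma>" "\<gamma> 0 = p"
      "positively_oriented M (arc_length M) \<gamma>"
    and \<xi>: "arc_length_parametrization N \<xi>" "\<xi> 0 = q"
      "positively_oriented N (arc_length N) \<xi>"
    and v: "\<And>t. t \<in> {0..arc_length M} \<Longrightarrow> v t = arc_length N / arc_length M * t"
    and w: "\<And>t. t \<in> {0..arc_length M} \<Longrightarrow>
      w t = - (arc_length N / arc_length M) * t + arc_length N"
    and h1: "h1 = restrict (\<xi> \<circ> v \<circ> the_inv_into {0..<arc_length M} \<gamma>) M"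
    and h2: "h2 = restrict (\<xi> \<circ> w \<circ> the_inv_into {0..<arc_length M} \<gamma>) M"
    and le: "arc_length M \<le> arc_length N"
  shows "{h. is_arg_min (deformation_energy M N) (\<lambda>k. k \<in> admissible M N p q) h} = {h1, h2} \<and>
    h1 \<noteq> h2 \<and>
    orientation_preserving M N h1 \<and>
    orientation_reversing M N h2 \<and>
    (\<exists>h\<in>admissible M N p q. deformation_energy M N h =
           ((arc_length N)\<^sup>2 - (arc_length M)\<^sup>2)\<^sup>2 / (arc_length M) ^ 3) \<and>
    (\<forall>h\<in>admissible M N p q.
           ((arc_length N)\<^sup>2 - (arc_length M)\<^sup>2)\<^sup>2 / (arc_length M) ^ 3 \<le> deformation_energy M N h)"
proof -
  define L where "L = arc_length M"
  define K where "K = arc_length N"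
  obtain c where c: "unit_speed_loop M L c" "\<And>t. t \<in> {0..L} \<Longrightarrow> \<gamma> t = c t" "positively_oriented M L c"
    using arc_length_parametrizationE[OF \<gamma>(1)] \<gamma>(3) unfolding L_def by blast
  obtain k where k: "unit_speed_loop N K k" "\<And>t. t \<in> {0..K} \<Longrightarrow> \<xi> t = k t" "positively_oriented N K k"
    using arc_length_parametrizationE[OF \<xi>(1)] \<xi>(3) unfolding K_def by blast
  interpret M: unit_speed_loop M L c by (rule c(1))
  interpret N: unit_speed_loop N K k by (rule k(1))
  interpret unit_speed_loops M L c N K k ..
  define r where "r = K / L"
  define \<mu> where "\<mu> = (K\<^sup>2 - L\<^sup>2)\<^sup>2 / L ^ 3"
  note L_pos = M.L_pos and K_pos = N.L_pos
  have r: "0 < r" "r * L = K" using L_pos K_pos by (auto simp: r_def)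
  have p: "p = c 0" using \<gamma>(2) c(2) L_pos by auto
  have q: "q = k 0" using \<xi>(2) k(2) K_pos by auto
  have inj: "inj_on \<gamma> {0..<L}"
    using M.par c(2) unfolding closed_parametrization_def by (auto simp: inj_on_def)
  \<comment> \<open>The inverse returns the representative of \<open>t\<close> in one period. This
    makes the formulas for \<open>h1\<close> and \<open>h2\<close> below valid at every real
    \<open>t\<close>.\<close>
  have inv: "\<exists>n::int. the_inv_into {0..<L} \<gamma> (c t) = t + of_int n * L \<and> t + of_int n * L \<in> {0..L}" for t
  proof -
    obtain n :: int where n: "t + of_int n * L \<in> {0..<0 + L}" using translate_into_period[OF L_pos] .
    then have "\<gamma> (t + of_int n * L) = c t" using c(2) M.periodic by simp
    then show ?thesis using the_inv_into_f_f[OF inj, of "t + of_int n * L"] n by auto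
  qed
  have h1_c: "h1 (c t) = k (r * t)" for t
  proof -
    obtain n :: int where n: "the_inv_into {0..<L} \<gamma> (c t) = t + of_int n * L" "t + of_int n * L \<in> {0..L}"
      using inv by blast
    then have "r * (t + of_int n * L) \<in> {0..r * L}" using r(1) by (auto intro: mult_left_mono)
    then have "h1 (c t) = k (r * (t + of_int n * L))"
      using n v k(2) r(2) by (simp add: h1 flip: L_def K_def r_def)
    also have "r * (t + of_int n * L) = r * t + of_int n * K" by (simp add: algebra_simps flip: r(2))
    finally show ?thesis by (simp add: N.periodic)
  qed
  have h2_c: "h2 (c t) = k (- r * t)" for t
  proof -
    obtain n :: int where n: "the_inv_into {0..<L} \<gamma> (c t) = t + of_int n * L" "t + of_int n * L \<in> {0..L}"
      using inv by blast
    then have "r * (t + of_int n * L) \<in> {0..r * L}" using r(1) by (auto intro: mult_left_mono)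
    then have "- r * (t + of_int n * L) + K \<in> {0..K}" using r(2) by auto
    then have "h2 (c t) = k (- r * (t + of_int n * L) + K)"
      using n w k(2) by (simp add: h2 flip: L_def K_def r_def)
    \<comment> \<open>The summand \<open>K\<close> from \<open>w\<close> is one more period of
      \<open>k\<close>, hence the factor \<open>1 - n\<close>.\<close>
    also have "- r * (t + of_int n * L) + K = - r * t + of_int (1 - n) * K"
      by (simp add: algebra_simps flip: r(2))
    finally show ?thesis by (simp only: N.periodic)
  qed
  have ext: "h1 \<in> extensional M" "h2 \<in> extensional M" by (auto simp: h1 h2)
  have abs: "\<bar>r\<bar> = K / L" "\<bar>- r\<bar> = K / L" using L_pos K_pos by (auto simp: r_def)
  have adm: "h1 \<in> admissible M N p q" "h2 \<in> admissible M N p q"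
    using Diff_of_affine[OF ext(1) h1_c abs(1)] Diff_of_affine[OF ext(2) h2_c abs(2)] h1_c[of 0] h2_c[of 0]
    by (auto simp: admissible_def p q)
  have energy: "deformation_energy M N h1 = \<mu>" "deformation_energy M N h2 = \<mu>"
    using deformation_energy_affine[OF h1_c abs(1)] deformation_energy_affine[OF h2_c abs(2)]
    by (auto simp: \<mu>_def)
  have admD: "h \<in> Diff M N" "h (c 0) = k 0" "h \<in> extensional M" if "h \<in> admissible M N p q" for h
    using that by (auto simp: admissible_def Diff_def p q)
  have le: "L \<le> K" using le by (simp add: L_def K_def)
  have bound: "\<mu> \<le> deformation_energy M N h" if "h \<in> admissible M N p q" for h
    unfolding \<mu>_def using deformation_energy_bound(1)[OF le] admD[OF that] by blast
  have unique: "h = h1 \<or> h = h2" if "h \<in> admissible M N p q" "deformation_energy M N h \<le> \<mu>" for h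
  proof -
    have "(\<forall>t\<in>{0..L}. h (c t) = k (r * t)) \<or> (\<forall>t\<in>{0..L}. h (c t) = k (- r * t))"
      using deformation_energy_bound(2)[OF le] admD[OF that(1)] that(2) unfolding \<mu>_def r_def by blast
    then show ?thesis
      using extensional_eqI[OF admD(3)[OF that(1)]] ext h1_c h2_c by (metis atLeastLessThan_iff atLeastAtMost_iff less_imp_le)
  qed
  have "h1 \<noteq> h2"
  proof
    assume "h1 = h2"
    \<comment> \<open>The two maps agree at the parameters 0 and \<open>L / 2\<close>. At
      \<open>L / 4\<close> the image parameters are \<open>K / 4\<close> and \<open>- K / 4\<close>,
      half a period apart.\<close>
    then have "k (r * (L / 4)) = k (- r * (L / 4))" using h1_c h2_c by metis
    then obtain n :: int where "r * (L / 4) = - r * (L / 4) + of_int n * K" using N.eq_iff by blast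
    then have "real_of_int n = 1 / 2" using r K_pos by (simp add: field_simps)
    then have "2 * n = 1" by linarith
    then show False by presburger
  qed
  moreover have "{h. is_arg_min (deformation_energy M N) (\<lambda>k. k \<in> admissible M N p q) h} = {h1, h2}"
    using adm energy bound unique unfolding is_arg_min_def by (auto simp: not_less)
  ultimately show ?thesis
    using orientation_of_affine(1)[OF c(3) k(3) h1_c r(1)] orientation_of_affine(2)[OF c(3) k(3) h2_c] r(1)
      adm energy bound unfolding \<mu>_def L_def K_def by auto
qed

end
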